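(* Let $(V,H,V')$ be a normal triple of Hilbert spaces and let $\mathbf A:V\to V'$ be a bounded linear operator such that for every $F\in V'$ there exists a unique $U=\mathbf A^{-1}F\in V$ with $\mathbf AU=F$, and $\|U\|_V\le C_A\|F\|_{V'}$. Let each $\mathbf M_k$, $k\ge1$, be a bounded linear operator from $V$ to $V'$ with $\|\mathbf A^{-1}\mathbf M_kv\|_V\le C_k\|v\|_V$ for all $v\in V$, $C_k$ independent of $v$. Let $f\in V'$ be non-random and let $u=\sum_\alpha u_\alpha\xi_\alpha$ be the solution of $$\mathbf Au+\sum_{k\ge1}(\mathbf M_ku)\diamond\xi_k=f.$$ Put $\mathbf B_k=-\mathbf A^{-1}\mathbf M_k$ and $u_{(0)}=\mathbf A^{-1}f$. Then: (1) For $\alpha$ with $|\alpha|=n\ge1$ and characteristic set $K_\alpha=\{k_1,\dots,k_n\}$, $$u_\alpha=\frac1{\sqrt{\alpha!}}\sum_{\sigma\in\mathcal P_n}\mathbf B_{k_{\sigma(n)}}\cdots\mathbf B_{k_{\sigma(1)}}u_{(0)},$$ where $\mathcal P_n$ is the permutation group of $(1,\dots,n)$. (2) $u\in\mathcal RL_2(\mathbb F;V)$ with the weights $$r_\alpha=\frac{q^\alpha}{\sqrt{|\alpha|!}},\qquad q^\alpha=\prod_{k\ge1}q_k^{\alpha_k},$$ where the positive numbers $q_k$ are chosen so that $\sum_{k\ge1}q_k^2C_k^2<1$. (3) With such $r_\alpha$ and $q_k$, and $\overline{\mathbf B}=-(q_1\mathbf A^{-1}\mathbf M_1,q_2\mathbf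 A^{-1}\mathbf M_2,\dots)$, for every $n\ge1$ $$\sum_{|\alpha|=n}q^\alpha u_\alpha\xi_\alpha=\delta^{(n)}_{\overline{\mathbf B}}(\mathbf A^{-1}f),$$ and $$\mathcal Ru=\mathbf A^{-1}f+\sum_{n\ge1}\frac1{\sqrt{n!}}\,\delta^{(n)}_{\overline{\mathbf B}}(\mathbf A^{-1}f).$$
   Context: Wiener chaos. $\mathbb F=(\Omega,\mathcal F,\mathbb P)$ is a complete probability space, $\mathcal U$ a real separable Hilbert space with orthonormal basis $\{\mathfrak u_k\}_{k\ge1}$, $\dot W=\{\dot W(h),h\in\mathcal U\}$ a zero-mean Gaussian family with $\mathbb E(\dot W(h_1)\dot W(h_2))=(h_1,h_2)_{\mathcal U}$, and $\mathcal F$ is generated by $\dot W$. Put $\xi_k=\dot W(\mathfrak u_k)$. $\mathcal J$ is the set of multi-indices $\alpha=(\alpha_1,\alpha_2,\dots)$ of non-negative integers with $|\alpha|=\sum_k\alpha_k<\infty$; $\alpha!=\prod_k\alpha_k!$; $(0)$ is the zero multi-index; $\varepsilon_k$ has $1$ in position $k$ and $0$ elsewhere. $\xi_\alpha=\prod_k H_{\alpha_k}(\xi_k)/\sqrt{\alpha_k!}$, $H_n(x)=(-1)^ne^{x^2/2}\frac{d^n}{dx^n}e^{-x^2/2}$. The characteristic set $K_\alpha$ of $\alpha$ with $|\alpha|=n\ge1$ is the ordered $n$-tuple $k_1\le\dots\le k_n$ in which each index $k$ is repeated $\alpha_k$ times. Weighted spaces. For positive weights $\{r_\alpha\}_{\alpha\in\mathcal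 J}$ and a Hilbert space $X$, $\mathcal R L_2(\mathbb F;X)$ is the space of formal series $v=\sum_{\alpha}v_\alpha\xi_\alpha$, $v_\alpha\in X$, with $\sum_\alpha r_\alpha^2\|v_\alpha\|_X^2<\infty$, and $\mathcal Rv=\sum_\alpha r_\alpha v_\alpha\xi_\alpha$. Normal triple: dense continuous embeddings $V\hookrightarrow H\hookrightarrow V'$, $V'$ is the dual of $V$ relative to the inner product of $H$, and $|(h,v)_H|\le C\|v\|_V\|h\|_{V'}$ for $v\in V,h\in H$. The operators $\delta^{(n)}$: for $\mathbf B=(\mathbf B_1,\mathbf B_2,\dots)$ with $\mathbf B_k:V\to V$ (so $\mathbf Bv=\sum_k(\mathbf B_kv)\otimes\mathfrak u_k$) and a formal series $\eta=\sum_\alpha\eta_\alpha\xi_\alpha$ with coefficients in $V$, $\delta(\mathbf B\eta)=\sum_k(\mathbf B_k\eta)\diamond\xi_k$ is the formal series with $\alpha$-th coefficient $\sum_k\sqrt{\alpha_k}\,\mathbf B_k\eta_{\alpha-\varepsilon_k}$ (terms with $\alpha_k=0$ are zero). Then $\delta^{(0)}_{\mathbf B}(\eta)=\eta$, $\delta^{(n)}_{\mathbf B}(\eta)=\delta(\mathbf B\,\delta^{(n-1)}_{\mathbf B}(\eta))$. Solution: $u=\sum_\alpha u_\alpha\xi_\alpha$, $u_\alpha\in V$, such that for every $\alpha\in\mathcal J$, $\mathbf Au_\alpha+\sum_{k\ge1}\sqrt{\alpha_k}\,\mathbf M_ku_{\alpha-\varepsilon_k}=f\,I_{(\alpha=(0))}$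 in $V'$; this system determines $u$ uniquely. *)

theory Defs
  imports
    "HOL-Probability.Probability"
    "HOL-Combinatorics.Permutations"
    "HOL-Library.Poly_Mapping"
begin

section \<open>Multi-indices\<close>

text \<open>Positions are numbered from \<open>0\<close> instead of \<open>1\<close>, both in multi-indices and in
  characteristic sets.\<close>

type_synonym multi_index = "nat \<Rightarrow>\<^sub>0 nat"

abbreviation mi_unit :: "nat \<Rightarrow> multi_index" where
  "mi_unit k \<equiv> Poly_Mapping.single k 1"

definition mi_deg :: "multi_index \<Rightarrow> nat" where
  "mi_deg \<alpha> = (\<Sum>k\<in>Poly_Mapping.keys \<alpha>. Poly_Mapping.lookup \<alpha> k)"

definition mi_fact :: "multi_index \<Rightarrow> nat" where
  "mi_fact \<alpha> = (\<Prod>k\<in>Poly_Mapping.keys \<alpha>. fact (Poly_Mapping.lookup \<alpha> k))"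

definition mi_power :: "(nat \<Rightarrow> real) \<Rightarrow> multi_index \<Rightarrow> real" where
  "mi_power q \<alpha> = (\<Prod>k\<in>Poly_Mapping.keys \<alpha>. q k ^ Poly_Mapping.lookup \<alpha> k)"

definition characteristic_set :: "multi_index \<Rightarrow> nat list" where
  "characteristic_set \<alpha> =
    concat (map (\<lambda>k. replicate (Poly_Mapping.lookup \<alpha> k) k)
      (sorted_list_of_set (Poly_Mapping.keys \<alpha>)))"


section \<open>Wiener chaos\<close>

text \<open>The point mass at \<open>0\<close> counts as a centred Gaussian law.\<close>

definition centered_gaussian :: "'a measure \<Rightarrow> ('a \<Rightarrow> real) \<Rightarrow> bool" where
  "centered_gaussian P X \<longleftrightarrow>
    X \<in> borel_measurable P \<and>
    ((AE \<omega> in P. X \<omega> = 0) \<or>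
     (\<exists>\<sigma>>0. distributed P lborel X (\<lambda>x. ennreal (normal_density 0 \<sigma> x))))"

definition centered_gaussian_family :: "'a measure \<Rightarrow> ('i \<Rightarrow> 'a \<Rightarrow> real) \<Rightarrow> bool" where
  "centered_gaussian_family P W \<longleftrightarrow>
    (\<forall>S c. finite S \<longrightarrow> centered_gaussian P (\<lambda>\<omega>. \<Sum>h\<in>S. c h * W h \<omega>))"

text \<open>As usual for a complete space, ``generated by the noise'' is understood up to null sets; the
  \<open>\<sigma>\<close>-algebra assumption also holds if the events are exactly the sets generated by the noise.\<close>

locale wiener_chaos = prob_space P + complete_measure P
  for P :: "'a measure" +
  fixes W :: "'u :: {real_inner, complete_space, second_countable_topology} \<Rightarrow> 'a \<Rightarrow> real"
    and e :: "nat \<Rightarrow> 'u"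
  assumes basis_orthonormal: "e j \<bullet> e k = (if j = k then 1 else 0)"
    and basis_total: "closure (span (range e)) = UNIV"
    and noise_gaussian: "centered_gaussian_family P W"
    and noise_covariance: "expectation (\<lambda>\<omega>. W h1 \<omega> * W h2 \<omega>) = h1 \<bullet> h2"
    and events_generated:
      "sets P = sigma_sets (space P)
        ({W h -` S \<inter> space P | h S. S \<in> sets borel} \<union> null_sets P)"

definition hermite :: "nat \<Rightarrow> real \<Rightarrow> real" where
  "hermite n x = (-1) ^ n * exp (x\<^sup>2 / 2) * (deriv ^^ n) (\<lambda>y. exp (- (y\<^sup>2) / 2)) x"

definition chaos_basis ::
    "('u \<Rightarrow> 'a \<Rightarrow> real) \<Rightarrow> (nat \<Rightarrow> 'u) \<Rightarrow> multi_index \<Rightarrow> 'a \<Rightarrow> real" where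
  "chaos_basis W e \<alpha> \<omega> =
    (\<Prod>k\<in>Poly_Mapping.keys \<alpha>.
      hermite (Poly_Mapping.lookup \<alpha> k) (W (e k) \<omega>) / sqrt (fact (Poly_Mapping.lookup \<alpha> k)))"


section \<open>Formal chaos series and weighted spaces\<close>

text \<open>A formal series \<open>\<Sum>\<alpha>. v\<^sub>\<alpha> \<xi>\<^sub>\<alpha>\<close> is the family of its coefficients.\<close>

type_synonym 'x chaos_series = "multi_index \<Rightarrow> 'x"

definition nonrandom :: "'x :: zero \<Rightarrow> 'x chaos_series" where
  "nonrandom x = (\<lambda>\<alpha>. if \<alpha> = 0 then x else 0)"

definition weighted_L2 :: "(multi_index \<Rightarrow> real) \<Rightarrow> 'x :: real_normed_vector chaos_series set" where
  "weighted_L2 r = {v. (\<lambda>\<alpha>. (r \<alpha>)\<^sup>2 * (norm (v \<alpha>))\<^sup>2) summable_on UNIV}"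

definition weight_op ::
    "(multi_index \<Rightarrow> real) \<Rightarrow> 'x :: real_vector chaos_series \<Rightarrow> 'x chaos_series" where
  "weight_op r v = (\<lambda>\<alpha>. r \<alpha> *\<^sub>R v \<alpha>)"

definition L2_tendsto ::
    "'a measure \<Rightarrow> ('i \<Rightarrow> 'a \<Rightarrow> 'x :: real_normed_vector) \<Rightarrow> ('a \<Rightarrow> 'x) \<Rightarrow> 'i filter \<Rightarrow> bool" where
  "L2_tendsto P Z X F \<longleftrightarrow>
    ((\<lambda>i. \<integral>\<^sup>+ \<omega>. ennreal ((norm (Z i \<omega> - X \<omega>))\<^sup>2) \<partial>P) \<longlongrightarrow> 0) F"

text \<open>The random element \<open>X\<close> is the sum in \<open>L\<^sub>2\<close> of the series with coefficients \<open>v\<close>.\<close>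

definition has_chaos_expansion ::
    "'a measure \<Rightarrow> ('u \<Rightarrow> 'a \<Rightarrow> real) \<Rightarrow> (nat \<Rightarrow> 'u) \<Rightarrow>
      ('a \<Rightarrow> 'x :: real_normed_vector) \<Rightarrow> 'x chaos_series \<Rightarrow> bool" where
  "has_chaos_expansion P W e X v \<longleftrightarrow>
    X \<in> borel_measurable P \<and>
    L2_tendsto P (\<lambda>S \<omega>. \<Sum>\<alpha>\<in>S. chaos_basis W e \<alpha> \<omega> *\<^sub>R v \<alpha>) X (finite_subsets_at_top UNIV)"


section \<open>The operators \<open>\<delta>\<close> and the stochastic equation\<close>

text \<open>\<open>skorohod B \<eta>\<close> is \<open>\<delta>(B\<eta>)\<close>, the sum over \<open>k\<close> of the Wick products of \<open>B\<^sub>k \<eta>\<close> and \<open>\<xi>\<^sub>k\<close>.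
  Indices outside \<open>keys \<alpha>\<close> contribute \<open>0\<close>.\<close>

definition skorohod ::
    "(nat \<Rightarrow> 'x \<Rightarrow> 'y :: real_vector) \<Rightarrow> 'x chaos_series \<Rightarrow> 'y chaos_series" where
  "skorohod B \<eta> =
    (\<lambda>\<alpha>. \<Sum>k\<in>Poly_Mapping.keys \<alpha>.
      sqrt (real (Poly_Mapping.lookup \<alpha> k)) *\<^sub>R B k (\<eta> (\<alpha> - mi_unit k)))"

primrec skorohod_iter ::
    "(nat \<Rightarrow> 'x \<Rightarrow> 'x :: real_vector) \<Rightarrow> nat \<Rightarrow> 'x chaos_series \<Rightarrow> 'x chaos_series" where
  "skorohod_iter B 0 \<eta> = \<eta>"
| "skorohod_iter B (Suc n) \<eta> = skorohod B (skorohod_iter B n \<eta>)"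

definition chaos_solution ::
    "('v \<Rightarrow> 'w :: real_vector) \<Rightarrow> (nat \<Rightarrow> 'v \<Rightarrow> 'w) \<Rightarrow> 'w \<Rightarrow> 'v chaos_series \<Rightarrow> bool" where
  "chaos_solution A M f u \<longleftrightarrow> (\<forall>\<alpha>. A (u \<alpha>) + skorohod M u \<alpha> = nonrandom f \<alpha>)"

text \<open>The embeddings are explicit maps \<open>i : V \<rightarrow> H\<close> and \<open>j : H \<rightarrow> V'\<close>; \<open>D\<close> identifies \<open>V'\<close> with the
  space of continuous functionals on \<open>V\<close>, extending the inner product of \<open>H\<close>.\<close>

definition normal_triple ::
    "('v :: {real_inner, complete_space} \<Rightarrow> 'h :: {real_inner, complete_space}) \<Rightarrow>
      ('h \<Rightarrow> 'w :: {real_inner, complete_space}) \<Rightarrow> bool" where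
  "normal_triple i j \<longleftrightarrow>
    bounded_linear i \<and> inj i \<and> closure (range i) = UNIV \<and>
    bounded_linear j \<and> inj j \<and> closure (range j) = UNIV \<and>
    (\<exists>D :: 'w \<Rightarrow> 'v \<Rightarrow>\<^sub>L real. bounded_linear D \<and> bij D \<and>
      (\<forall>h v. blinfun_apply (D (j h)) v = h \<bullet> i v)) \<and>
    (\<exists>C. \<forall>h v. \<bar>h \<bullet> i v\<bar> \<le> C * norm v * norm (j h))"

end

theory Submission
  imports Defs "HOL-Computational_Algebra.Polynomial"
begin

text \<open>
  Applying \<open>A\<^sup>-\<^sup>1\<close> to the equation for the coefficients gives \<open>u\<^sub>\<alpha> = \<Sum>k. \<surd>\<alpha>\<^sub>k B\<^sub>k u\<^bsub>\<alpha> - \<epsilon>\<^sub>k\<^esub>\<close> for \<open>\<alpha> \<noteq> 0\<close>.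
  Splitting the permutations of the characteristic set according to the value at the last position
  yields the same recursion for \<open>\<surd>\<alpha>! u\<^sub>\<alpha>\<close>. The coefficients \<open>w\<^sub>\<alpha> = q\<^sup>\<alpha> u\<^sub>\<alpha>\<close> obey the recursion with
  \<open>q\<^sub>k B\<^sub>k\<close> in place of \<open>B\<^sub>k\<close>, so the level \<open>|\<alpha>| = n\<close> of \<open>w\<close> is the \<open>n\<close>-th iterate of \<open>\<delta>\<close>. By
  Cauchy-Schwarz and \<open>\<Sum>k. \<alpha>\<^sub>k = |\<alpha>|\<close>, the numbers \<open>y\<^sub>\<alpha> = \<parallel>w\<^sub>\<alpha>\<parallel>\<^sup>2 / |\<alpha>|!\<close> satisfy
  \<open>y\<^sub>\<alpha> \<le> \<Sum>k. q\<^sub>k\<^sup>2 C\<^sub>k\<^sup>2 y\<^bsub>\<alpha> - \<epsilon>\<^sub>k\<^esub>\<close>, whence their sum over the level \<open>n\<close> is at most \<open>(\<Sum>k. q\<^sub>k\<^sup>2 C\<^sub>k\<^sup>2)\<^sup>n y\<^sub>0\<close>.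

  The chaos basis is orthonormal because the mixed moments of the \<open>\<xi>\<^sub>k\<close> are determined by the moments
  of their linear combinations, which are Gaussian; Gaussian integration by parts then gives the
  orthogonality of the Hermite polynomials. Along finite index sets whose tails decrease
  geometrically the partial sums of a square-summable chaos series converge almost surely, and
  Fatou's lemma bounds the remainder in \<open>L\<^sub>2\<close>.
\<close>

subsection \<open>Multi-indices\<close>

text \<open>A zero exponent contributes the neutral element. Multi-indices with different supports
  can therefore be compared over one common finite set of positions.\<close>

lemma sum_keys_superset:
  assumes "finite T" "Poly_Mapping.keys \<alpha> \<subseteq> T" "\<And>k. g k 0 = (0 :: 'b :: comm_monoid_add)"
  shows "(\<Sum>k\<in>Poly_Mapping.keys \<alpha>. g k (Poly_Mapping.lookup \<alpha> k))
    = (\<Sum>k\<in>T. g k (Poly_Mapping.lookup \<alpha> k))"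
  using assms by (intro sum.mono_neutral_left) (auto simp: in_keys_iff)

lemma prod_keys_superset:
  assumes "finite T" "Poly_Mapping.keys \<alpha> \<subseteq> T" "\<And>k. g k 0 = (1 :: 'b :: comm_monoid_mult)"
  shows "(\<Prod>k\<in>Poly_Mapping.keys \<alpha>. g k (Poly_Mapping.lookup \<alpha> k))
    = (\<Prod>k\<in>T. g k (Poly_Mapping.lookup \<alpha> k))"
  using assms by (intro prod.mono_neutral_left) (auto simp: in_keys_iff)

text \<open>Subtraction of multi-indices is truncated componentwise, so adding the unit back
  restores \<alpha> only where the component at \<open>k\<close> is positive.\<close>

lemma diff_add_mi_unit:
  "k \<in> Poly_Mapping.keys \<alpha> \<Longrightarrow> \<alpha> - mi_unit k + mi_unit k = \<alpha>"
  by (rule poly_mapping_eqI) (auto simp: lookup_add lookup_minus lookup_single in_keys_iff when_def)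

lemma keys_add_mi_unit: "Poly_Mapping.keys (\<beta> + mi_unit k) = insert k (Poly_Mapping.keys \<beta>)"
  by (auto simp: in_keys_iff lookup_add lookup_single when_def split: if_splits)

lemma lookup_add_mi_unit:
  "Poly_Mapping.lookup (\<beta> + mi_unit k) l
    = (if l = k then Suc (Poly_Mapping.lookup \<beta> l) else Poly_Mapping.lookup \<beta> l)"
  by (auto simp: lookup_add lookup_single when_def)

text \<open>Raising the exponent at \<open>k\<close> by one changes a single factor. The neutral
  value at exponent 0 covers the case that \<open>k\<close> is a new position. Used for factorials,
  with \<open>c\<close> the raised exponent, and for powers, with \<open>c = q k\<close>.\<close>

lemma prod_keys_add_mi_unit:
  fixes g :: "nat \<Rightarrow> nat \<Rightarrow> 'b :: comm_monoid_mult"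
  assumes g0: "\<And>k. g k 0 = 1" and gS: "g k (Suc (Poly_Mapping.lookup \<beta> k)) = c * g k (Poly_Mapping.lookup \<beta> k)"
  shows "(\<Prod>l\<in>Poly_Mapping.keys (\<beta> + mi_unit k). g l (Poly_Mapping.lookup (\<beta> + mi_unit k) l))
    = c * (\<Prod>l\<in>Poly_Mapping.keys \<beta>. g l (Poly_Mapping.lookup \<beta> l))"
proof -
  let ?T = "insert k (Poly_Mapping.keys \<beta>)"
  have "(\<Prod>l\<in>Poly_Mapping.keys (\<beta> + mi_unit k). g l (Poly_Mapping.lookup (\<beta> + mi_unit k) l))
      = (\<Prod>l\<in>?T. (if l = k then c else 1) * g l (Poly_Mapping.lookup \<beta> l))"
    unfolding keys_add_mi_unit by (intro prod.cong) (auto simp: lookup_add_mi_unit gS simp del: One_nat_def)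
  also have "\<dots> = c * (\<Prod>l\<in>?T. g l (Poly_Mapping.lookup \<beta> l))"
    by (simp add: prod.distrib prod.delta)
  also have "(\<Prod>l\<in>?T. g l (Poly_Mapping.lookup \<beta> l))
      = (\<Prod>l\<in>Poly_Mapping.keys \<beta>. g l (Poly_Mapping.lookup \<beta> l))"
    by (rule prod_keys_superset[symmetric]) (auto simp: g0)
  finally show ?thesis .
qed

lemma mi_deg_add_mi_unit: "mi_deg (\<beta> + mi_unit k) = Suc (mi_deg \<beta>)"
proof -
  let ?T = "insert k (Poly_Mapping.keys \<beta>)"
  have "mi_deg (\<beta> + mi_unit k)
      = (\<Sum>l\<in>?T. (if l = k then 1 else 0) + Poly_Mapping.lookup \<beta> l)"
    unfolding mi_deg_def keys_add_mi_unit by (intro sum.cong) (auto simp: lookup_add_mi_unit simp del: One_nat_def)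
  also have "\<dots> = Suc (\<Sum>l\<in>?T. Poly_Mapping.lookup \<beta> l)"
    by (simp add: sum.distrib sum.delta)
  also have "(\<Sum>l\<in>?T. Poly_Mapping.lookup \<beta> l) = mi_deg \<beta>"
    unfolding mi_deg_def by (rule sum_keys_superset[symmetric]) auto
  finally show ?thesis .
qed

lemma mi_fact_add_mi_unit:
  "mi_fact (\<beta> + mi_unit k) = Suc (Poly_Mapping.lookup \<beta> k) * mi_fact \<beta>"
  unfolding mi_fact_def by (rule prod_keys_add_mi_unit) auto

lemma mi_power_add_mi_unit: "mi_power q (\<beta> + mi_unit k) = q k * mi_power q \<beta>"
  unfolding mi_power_def by (rule prod_keys_add_mi_unit) auto

lemma mi_deg_diff_mi_unit:
  assumes "k \<in> Poly_Mapping.keys \<alpha>"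
  shows "mi_deg \<alpha> = Suc (mi_deg (\<alpha> - mi_unit k))"
  by (metis assms diff_add_mi_unit mi_deg_add_mi_unit)

lemma mi_fact_diff_mi_unit:
  assumes "k \<in> Poly_Mapping.keys \<alpha>"
  shows "mi_fact \<alpha> = Poly_Mapping.lookup \<alpha> k * mi_fact (\<alpha> - mi_unit k)"
  by (metis assms diff_add_mi_unit mi_fact_add_mi_unit lookup_add_mi_unit)

lemma mi_power_diff_mi_unit:
  assumes "k \<in> Poly_Mapping.keys \<alpha>"
  shows "mi_power q \<alpha> = q k * mi_power q (\<alpha> - mi_unit k)"
  by (metis assms diff_add_mi_unit mi_power_add_mi_unit)

lemma mi_deg_eq_0_iff: "mi_deg \<alpha> = 0 \<longleftrightarrow> \<alpha> = 0"
  by (auto simp: mi_deg_def in_keys_iff intro!: poly_mapping_eqI)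

lemma mi_zero_simps [simp]: "mi_deg 0 = 0" "mi_fact 0 = 1" "mi_power q 0 = 1"
  by (simp_all add: mi_deg_def mi_fact_def mi_power_def)

lemma mi_fact_pos: "mi_fact \<alpha> > 0"
  by (simp add: mi_fact_def prod_pos)

text \<open>The multiplicities are the only information about the characteristic set that enters the
  permutation formula: a sum over all permutations does not see the order of the list.\<close>

lemma count_characteristic_set:
  "count (mset (characteristic_set \<alpha>)) k = Poly_Mapping.lookup \<alpha> k"
proof -
  have "count (mset (concat (map (\<lambda>k. replicate (n k) k) ks))) k = (if k \<in> set ks then n k else 0)"
    if "distinct ks" for ks :: "nat list" and n :: "nat \<Rightarrow> nat"
    using that by (induction ks) auto
  from this[of "sorted_list_of_set (Poly_Mapping.keys \<alpha>)" "Poly_Mapping.lookup \<alpha>"]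
  show ?thesis
    by (auto simp: characteristic_set_def in_keys_iff)
qed

lemma length_eq_mi_deg:
  assumes "\<And>k. count (mset xs) k = Poly_Mapping.lookup \<alpha> k"
  shows "length xs = mi_deg \<alpha>"
proof -
  have "set xs = Poly_Mapping.keys \<alpha>"
    using assms by (auto simp: in_keys_iff simp flip: set_mset_mset count_greater_zero_iff)
  then show ?thesis
    unfolding mi_deg_def size_mset[symmetric] size_multiset_overloaded_eq by (simp add: assms)
qed

subsection \<open>Summation over permutations\<close>

text \<open>Each permutation of n+1 points is uniquely a transposition of \<open>n\<close> and
  \<open>b\<close> after a permutation fixing \<open>n\<close>, and \<open>b\<close> is its value at
  \<open>n\<close>. The operator at position \<open>n\<close> is applied last by
  \<open>fold\<close>, so it comes out of the inner sum by linearity.\<close>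

lemma sum_permutations_fold_Suc:
  fixes B :: "nat \<Rightarrow> 'v \<Rightarrow> 'v :: real_vector"
  assumes lin: "\<And>k. linear (B k)"
  shows "(\<Sum>\<sigma> | \<sigma> permutes {..<Suc n}. fold (\<lambda>l. B (x (\<sigma> l))) [0..<Suc n] v)
    = (\<Sum>b<Suc n. B (x b) (\<Sum>\<sigma> | \<sigma> permutes {..<n}.
        fold (\<lambda>l. B ((x \<circ> Transposition.transpose n b) (\<sigma> l))) [0..<n] v))"
proof -
  have "(\<Sum>\<sigma> | \<sigma> permutes {..<Suc n}. fold (\<lambda>l. B (x (\<sigma> l))) [0..<Suc n] v)
    = (\<Sum>b<Suc n. \<Sum>\<sigma> | \<sigma> permutes {..<n}.
        fold (\<lambda>l. B (x ((Transposition.transpose n b \<circ> \<sigma>) l))) [0..<Suc n] v)"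
    unfolding lessThan_Suc by (rule sum_over_permutations_insert) auto
  also have "\<dots> = (\<Sum>b<Suc n. \<Sum>\<sigma> | \<sigma> permutes {..<n}.
        B (x b) (fold (\<lambda>l. B ((x \<circ> Transposition.transpose n b) (\<sigma> l))) [0..<n] v))"
  proof (intro sum.cong refl)
    fix b \<sigma> assume "\<sigma> \<in> {\<sigma>. \<sigma> permutes {..<n}}"
    then have "\<sigma> n = n"
      by (auto simp: permutes_def)
    then show "fold (\<lambda>l. B (x ((Transposition.transpose n b \<circ> \<sigma>) l))) [0..<Suc n] v
      = B (x b) (fold (\<lambda>l. B ((x \<circ> Transposition.transpose n b) (\<sigma> l))) [0..<n] v)"
      by (simp add: comp_def)
  qed
  also have "\<dots> = (\<Sum>b<Suc n. B (x b) (\<Sum>\<sigma> | \<sigma> permutes {..<n}.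
        fold (\<lambda>l. B ((x \<circ> Transposition.transpose n b) (\<sigma> l))) [0..<n] v))"
    by (simp add: linear_sum[OF lin])
  finally show ?thesis .
qed

text \<open>Removing entry \<open>b\<close> by overwriting it with the last entry, as the transposition in
  the recursion above does.\<close>

lemma count_map_transpose:
  assumes "length xs = Suc n" "b < Suc n"
  shows "count (mset (map (\<lambda>l. xs ! Transposition.transpose n b l) [0..<n])) k
    = count (mset xs) k - (if k = xs ! b then 1 else 0)"
proof -
  have p: "Transposition.transpose n b permutes {..<length xs}"
    using assms by (intro permutes_swap_id) auto
  have "mset xs = mset (permute_list (Transposition.transpose n b) xs)"
    by (rule mset_permute_list[OF p, symmetric])
  also have "permute_list (Transposition.transpose n b) xs = map (\<lambda>l. xs ! Transposition.transpose n b l) [0..<n] @ [xs ! b]"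
    using assms by (simp add: permute_list_def)
  finally show ?thesis
    by simp
qed

text \<open>Positions are grouped by their entry. This converts the sum over the choice of the last
  entry into the sum over \<open>k\<close> that occurs in the operator \<delta>.\<close>

lemma sum_positions_eq_sum_keys:
  fixes g :: "nat \<Rightarrow> 'v :: real_vector"
  assumes "\<And>k. count (mset xs) k = Poly_Mapping.lookup \<alpha> k"
  shows "(\<Sum>b<length xs. g (xs ! b))
    = (\<Sum>k\<in>Poly_Mapping.keys \<alpha>. real (Poly_Mapping.lookup \<alpha> k) *\<^sub>R g k)"
proof -
  have keys: "set xs = Poly_Mapping.keys \<alpha>"
    using assms by (auto simp: in_keys_iff simp flip: set_mset_mset count_greater_zero_iff)
  have "(\<Sum>b<length xs. g (xs ! b)) = (\<Sum>k\<in>Poly_Mapping.keys \<alpha>. \<Sum>b | b < length xs \<and> xs ! b = k. g (xs ! b))"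
    unfolding keys[symmetric] by (subst sum.group[symmetric, where T = "set xs" and g = "(!) xs"]) auto
  also have "\<dots> = (\<Sum>k\<in>Poly_Mapping.keys \<alpha>. real (Poly_Mapping.lookup \<alpha> k) *\<^sub>R g k)"
  proof (intro sum.cong refl)
    fix k
    have "card {b. b < length xs \<and> xs ! b = k} = Poly_Mapping.lookup \<alpha> k"
      using assms[of k] by (simp add: count_mset count_list_eq_length_filter length_filter_conv_card eq_commute)
    then show "(\<Sum>b | b < length xs \<and> xs ! b = k. g (xs ! b)) = real (Poly_Mapping.lookup \<alpha> k) *\<^sub>R g k"
      by (simp add: sum_constant_scaleR)
  qed
  finally show ?thesis .
qed

text \<open>The list is any arrangement of the entries instead of the sorted one, because the
  transposition in the induction step passes down a list that need not be sorted.\<close>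

lemma coefficient_eq_sum_permutations:
  fixes B :: "nat \<Rightarrow> 'v \<Rightarrow> 'v :: real_vector"
  assumes lin: "\<And>k. linear (B k)"
    and rec: "\<And>\<alpha>. \<alpha> \<noteq> 0 \<Longrightarrow> u \<alpha> = skorohod B u \<alpha>"
    and xs: "\<And>k. count (mset xs) k = Poly_Mapping.lookup \<alpha> k"
    and n: "mi_deg \<alpha> = n"
  shows "sqrt (real (mi_fact \<alpha>)) *\<^sub>R u \<alpha>
    = (\<Sum>\<sigma> | \<sigma> permutes {..<n}. fold (\<lambda>l. B (xs ! \<sigma> l)) [0..<n] (u 0))"
  using xs n
proof (induction n arbitrary: \<alpha> xs)
  case 0
  then show ?case
    by (simp add: mi_deg_eq_0_iff)
next
  case (Suc n)
  have len: "length xs = Suc n"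
    using length_eq_mi_deg[OF Suc.prems(1)] Suc.prems(2) by simp
  have "\<alpha> \<noteq> 0"
    using Suc.prems by auto
  let ?S = "\<lambda>b. \<Sum>\<sigma> | \<sigma> permutes {..<n}. fold (\<lambda>l. B (((!) xs \<circ> Transposition.transpose n b) (\<sigma> l))) [0..<n] (u 0)"
  let ?G = "\<lambda>k. B k (sqrt (real (mi_fact (\<alpha> - mi_unit k))) *\<^sub>R u (\<alpha> - mi_unit k))"
  have S: "?S b = sqrt (real (mi_fact (\<alpha> - mi_unit (xs ! b)))) *\<^sub>R u (\<alpha> - mi_unit (xs ! b))"
    if b: "b < Suc n" for b
  proof -
    define ys where "ys = map (\<lambda>l. xs ! Transposition.transpose n b l) [0..<n]"
    have "xs ! b \<in> set xs"
      using len b by simp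
    then have k: "xs ! b \<in> Poly_Mapping.keys \<alpha>"
      using Suc.prems(1)[of "xs ! b"] by (metis in_keys_iff count_mset_0_iff)
    have "count (mset ys) k = Poly_Mapping.lookup (\<alpha> - mi_unit (xs ! b)) k" for k
      unfolding ys_def count_map_transpose[OF len b]
      by (auto simp: Suc.prems(1) lookup_minus lookup_single when_def)
    moreover have "mi_deg (\<alpha> - mi_unit (xs ! b)) = n"
      using mi_deg_diff_mi_unit[OF k] Suc.prems(2) by simp
    ultimately have "sqrt (real (mi_fact (\<alpha> - mi_unit (xs ! b)))) *\<^sub>R u (\<alpha> - mi_unit (xs ! b))
      = (\<Sum>\<sigma> | \<sigma> permutes {..<n}. fold (\<lambda>l. B (ys ! \<sigma> l)) [0..<n] (u 0))"
      by (rule Suc.IH)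
    also have "\<dots> = ?S b"
    proof (intro sum.cong refl fold_cong)
      fix \<sigma> l assume "\<sigma> \<in> {\<sigma>. \<sigma> permutes {..<n}}" "l \<in> set [0..<n]"
      then have "\<sigma> l < n"
        using permutes_in_image[of \<sigma> "{..<n}" l] by simp
      then show "B (ys ! \<sigma> l) = B (((!) xs \<circ> Transposition.transpose n b) (\<sigma> l))"
        by (simp add: ys_def)
    qed
    finally show ?thesis ..
  qed
  have "(\<Sum>\<sigma> | \<sigma> permutes {..<Suc n}. fold (\<lambda>l. B (xs ! \<sigma> l)) [0..<Suc n] (u 0))
      = (\<Sum>b<Suc n. B (xs ! b) (?S b))"
    by (rule sum_permutations_fold_Suc[OF lin])
  also have "\<dots> = (\<Sum>b<length xs. ?G (xs ! b))"
    unfolding len by (intro sum.cong refl) (simp only: S lessThan_iff)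
  also have "\<dots> = (\<Sum>k\<in>Poly_Mapping.keys \<alpha>. real (Poly_Mapping.lookup \<alpha> k) *\<^sub>R ?G k)"
    by (rule sum_positions_eq_sum_keys[OF Suc.prems(1)])
  also have "\<dots> = sqrt (real (mi_fact \<alpha>)) *\<^sub>R skorohod B u \<alpha>"
    unfolding skorohod_def scaleR_sum_right
  proof (intro sum.cong refl)
    fix k assume "k \<in> Poly_Mapping.keys \<alpha>"
    \<comment> \<open>By \<alpha>! = \<alpha>_k (\<alpha> - \<epsilon>_k)!, the product of the root
      of \<alpha>! and the root of \<alpha>_k is \<alpha>_k times the root of (\<alpha> -
      \<epsilon>_k)!, so the multiplicity \<alpha>_k appears.\<close>
    from mi_fact_diff_mi_unit[OF this]
    show "real (Poly_Mapping.lookup \<alpha> k) *\<^sub>R ?G k = sqrt (real (mi_fact \<alpha>)) *\<^sub>R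
      sqrt (real (Poly_Mapping.lookup \<alpha> k)) *\<^sub>R B k (u (\<alpha> - mi_unit k))"
      by (simp add: linear_scale[OF lin] real_sqrt_mult)
  qed
  finally show ?case
    using rec[OF \<open>\<alpha> \<noteq> 0\<close>] by simp
qed

text \<open>The operator \<delta> raises the degree by exactly one, so the n-th iterate of a
  constant lives on level n. On that level it sees only level n-1 of \<open>w\<close>, where the
  recursion for \<open>w\<close> is the same operator.\<close>

lemma skorohod_iter_nonrandom:
  fixes B :: "nat \<Rightarrow> 'v \<Rightarrow> 'v :: real_vector"
  assumes lin: "\<And>k. linear (B k)"
    and rec: "\<And>\<alpha>. \<alpha> \<noteq> 0 \<Longrightarrow> w \<alpha> = skorohod B w \<alpha>"
  shows "skorohod_iter B n (nonrandom (w 0)) = (\<lambda>\<alpha>. if mi_deg \<alpha> = n then w \<alpha> else 0)"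
proof (induction n)
  case 0
  show ?case
    by (auto simp: nonrandom_def mi_deg_eq_0_iff)
next
  case (Suc n)
  show ?case
  proof
    fix \<alpha>
    have "skorohod_iter B (Suc n) (nonrandom (w 0)) \<alpha> = (\<Sum>k\<in>Poly_Mapping.keys \<alpha>.
      sqrt (real (Poly_Mapping.lookup \<alpha> k)) *\<^sub>R
        B k (if mi_deg (\<alpha> - mi_unit k) = n then w (\<alpha> - mi_unit k) else 0))"
      by (simp add: Suc skorohod_def)
    also have "\<dots> = (\<Sum>k\<in>Poly_Mapping.keys \<alpha>. if mi_deg \<alpha> = Suc n then
      sqrt (real (Poly_Mapping.lookup \<alpha> k)) *\<^sub>R B k (w (\<alpha> - mi_unit k)) else 0)"
      by (intro sum.cong) (auto simp: mi_deg_diff_mi_unit linear_0[OF lin])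
    also have "\<dots> = (if mi_deg \<alpha> = Suc n then w \<alpha> else 0)"
    proof (cases "mi_deg \<alpha> = Suc n")
      case True
      then have "\<alpha> \<noteq> 0"
        by auto
      from rec[OF this] True show ?thesis
        by (simp add: skorohod_def)
    qed simp
    finally show "skorohod_iter B (Suc n) (nonrandom (w 0)) \<alpha> = (if mi_deg \<alpha> = Suc n then w \<alpha> else 0)" .
  qed
qed

subsection \<open>Summability\<close>

text \<open>A pair of \<alpha> and a position \<open>k\<close> in its support is recovered from
  \<open>k\<close> and \<alpha> - \<epsilon>_k. The sum over level n+1 is thus dominated by the
  product of a sum of \<open>x\<close> and a sum over level n. Finite subsets are used since a level
  n \<ge> 1 is infinite.\<close>

lemma level_sum_bound:
  fixes y :: "multi_index \<Rightarrow> real" and x :: "nat \<Rightarrow> real"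
  assumes y: "\<And>\<alpha>. y \<alpha> \<ge> 0" and x: "\<And>k. x k \<ge> 0" "summable x"
    and rec: "\<And>\<alpha>. \<alpha> \<noteq> 0 \<Longrightarrow> y \<alpha> \<le> (\<Sum>k\<in>Poly_Mapping.keys \<alpha>. x k * y (\<alpha> - mi_unit k))"
    and F: "finite F" "\<And>\<alpha>. \<alpha> \<in> F \<Longrightarrow> mi_deg \<alpha> = n"
  shows "sum y F \<le> suminf x ^ n * y 0"
  using F
proof (induction n arbitrary: F)
  case 0
  then have "F \<subseteq> {0}"
    by (auto simp: mi_deg_eq_0_iff)
  then show ?case
    using sum_mono2[of "{0}" F y] y by auto
next
  case (Suc n)
  define D where "D = Sigma F Poly_Mapping.keys"
  define h where "h = (\<lambda>(\<alpha>, k). (k, \<alpha> - mi_unit k :: multi_index))"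
  have inj: "inj_on h D"
    by (rule inj_on_inverseI[where g = "\<lambda>(k, \<beta>). (\<beta> + mi_unit k, k)"])
      (auto simp: D_def h_def diff_add_mi_unit simp del: One_nat_def)
  have finD: "finite D"
    using Suc.prems by (auto simp: D_def)
  let ?K = "fst ` h ` D" and ?F = "snd ` h ` D"
  have deg: "mi_deg \<beta> = n" if "\<beta> \<in> ?F" for \<beta>
    using that Suc.prems(2) by (auto simp: D_def h_def dest: mi_deg_diff_mi_unit)
  have "sum y F \<le> (\<Sum>\<alpha>\<in>F. \<Sum>k\<in>Poly_Mapping.keys \<alpha>. x k * y (\<alpha> - mi_unit k))"
    using Suc.prems(2) by (intro sum_mono rec) force
  also have "\<dots> = (\<Sum>p\<in>D. case h p of (k, \<beta>) \<Rightarrow> x k * y \<beta>)"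
    unfolding D_def using Suc.prems by (subst sum.Sigma) (auto simp: h_def intro!: sum.cong)
  also have "\<dots> = (\<Sum>(k, \<beta>)\<in>h ` D. x k * y \<beta>)"
    by (subst sum.reindex[OF inj]) (simp add: comp_def)
  \<comment> \<open>Passing to the product of the two projections only adds nonnegative terms and
    lets the double sum factor.\<close>
  also have "\<dots> \<le> (\<Sum>(k, \<beta>)\<in>?K \<times> ?F. x k * y \<beta>)"
    using finD x y by (intro sum_mono2 subset_fst_snd) auto
  also have "\<dots> = sum x ?K * sum y ?F"
    by (simp add: sum_product sum.cartesian_product)
  also have "\<dots> \<le> suminf x * (suminf x ^ n * y 0)"
  proof (rule mult_mono)
    show "sum x ?K \<le> suminf x"
      using x finD by (intro sum_le_suminf) auto
    show "sum y ?F \<le> suminf x ^ n * y 0"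
      using finD deg by (intro Suc.IH) auto
  qed (auto intro!: suminf_nonneg sum_nonneg x y)
  finally show ?case
    by simp
qed

text \<open>A finite set meets finitely many levels, and the level bounds form a geometric series
  with ratio \<open>suminf x < 1\<close>.\<close>

lemma summable_on_multi_index:
  fixes y :: "multi_index \<Rightarrow> real" and x :: "nat \<Rightarrow> real"
  assumes y: "\<And>\<alpha>. y \<alpha> \<ge> 0" and x: "\<And>k. x k \<ge> 0" "summable x" "suminf x < 1"
    and rec: "\<And>\<alpha>. \<alpha> \<noteq> 0 \<Longrightarrow> y \<alpha> \<le> (\<Sum>k\<in>Poly_Mapping.keys \<alpha>. x k * y (\<alpha> - mi_unit k))"
  shows "y summable_on UNIV"
proof (rule nonneg_bdd_above_summable_on)
  have s: "0 \<le> suminf x"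
    using x by (intro suminf_nonneg) auto
  have "sum y F \<le> 1 / (1 - suminf x) * y 0" if F: "finite F" for F
  proof -
    have "sum y F = (\<Sum>n\<in>mi_deg ` F. sum y {\<alpha> \<in> F. mi_deg \<alpha> = n})"
      using F by (rule sum.image_gen)
    also have "\<dots> \<le> (\<Sum>n\<in>mi_deg ` F. suminf x ^ n * y 0)"
      using F x by (intro sum_mono level_sum_bound[OF y _ _ rec]) auto
    also have "\<dots> = (\<Sum>n\<in>mi_deg ` F. suminf x ^ n) * y 0"
      by (simp add: sum_distrib_right)
    also have "\<dots> \<le> suminf (\<lambda>n. suminf x ^ n) * y 0"
      using F s x y by (intro mult_right_mono sum_le_suminf summable_geometric) auto
    also have "\<dots> = 1 / (1 - suminf x) * y 0"
      using s x by (subst suminf_geometric) auto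
    finally show ?thesis .
  qed
  then show "bdd_above (sum y ` {F. F \<subseteq> UNIV \<and> finite F})"
    by (auto intro!: bdd_aboveI2)
qed (rule y)

lemma norm_skorohod_sq_le:
  fixes B :: "nat \<Rightarrow> 'v \<Rightarrow> 'v :: real_normed_vector"
  assumes B: "\<And>k v. norm (B k v) \<le> c k * norm v"
  shows "(norm (skorohod B w \<alpha>))\<^sup>2
    \<le> real (mi_deg \<alpha>) * (\<Sum>k\<in>Poly_Mapping.keys \<alpha>. (c k)\<^sup>2 * (norm (w (\<alpha> - mi_unit k)))\<^sup>2)"
proof -
  let ?K = "Poly_Mapping.keys \<alpha>" and ?a = "\<lambda>k. sqrt (real (Poly_Mapping.lookup \<alpha> k))"
    and ?b = "\<lambda>k. c k * norm (w (\<alpha> - mi_unit k))"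
  have "norm (skorohod B w \<alpha>) \<le> (\<Sum>k\<in>?K. ?a k * ?b k)"
    unfolding skorohod_def by (rule sum_norm_le) (auto intro!: mult_left_mono B)
  then have "(norm (skorohod B w \<alpha>))\<^sup>2 \<le> (\<Sum>k\<in>?K. ?a k * ?b k)\<^sup>2"
    by (intro power_mono) auto
  also have "\<dots> \<le> (\<Sum>k\<in>?K. (?a k)\<^sup>2) * (\<Sum>k\<in>?K. (?b k)\<^sup>2)"
    by (rule Cauchy_Schwarz_ineq_sum)
  also have "\<dots> = real (mi_deg \<alpha>) * (\<Sum>k\<in>?K. (c k)\<^sup>2 * (norm (w (\<alpha> - mi_unit k)))\<^sup>2)"
    by (simp add: mi_deg_def power_mult_distrib)
  finally show ?thesis .
qed

lemma weighted_coefficients_summable: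
  fixes B :: "nat \<Rightarrow> 'v \<Rightarrow> 'v :: real_normed_vector"
  assumes B: "\<And>k v. norm (B k v) \<le> c k * norm v"
    and rec: "\<And>\<alpha>. \<alpha> \<noteq> 0 \<Longrightarrow> w \<alpha> = skorohod B w \<alpha>"
    and c: "summable (\<lambda>k. (c k)\<^sup>2)" "suminf (\<lambda>k. (c k)\<^sup>2) < 1"
  shows "(\<lambda>\<alpha>. (norm (w \<alpha>))\<^sup>2 / fact (mi_deg \<alpha>)) summable_on UNIV"
proof (rule summable_on_multi_index[OF _ _ c])
  fix \<alpha> :: multi_index assume "\<alpha> \<noteq> 0"
  then obtain n where n: "mi_deg \<alpha> = Suc n"
    using mi_deg_eq_0_iff not0_implies_Suc by blast
  have "(norm (w \<alpha>))\<^sup>2 / fact (mi_deg \<alpha>)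
      \<le> real (mi_deg \<alpha>) * (\<Sum>k\<in>Poly_Mapping.keys \<alpha>. (c k)\<^sup>2 * (norm (w (\<alpha> - mi_unit k)))\<^sup>2) / fact (mi_deg \<alpha>)"
    using norm_skorohod_sq_le[where B = B and c = c and w = w and \<alpha> = \<alpha>, OF B] rec[OF \<open>\<alpha> \<noteq> 0\<close>] by (intro divide_right_mono) auto
  \<comment> \<open>The factor |\<alpha>| produced by Cauchy-Schwarz cancels against |\<alpha>|!;
    this is the purpose of the factorial in the weights.\<close>
  also have "\<dots> = (\<Sum>k\<in>Poly_Mapping.keys \<alpha>. (c k)\<^sup>2 * (norm (w (\<alpha> - mi_unit k)))\<^sup>2) / fact n"
    unfolding n fact_Suc by (simp del: of_nat_Suc)
  also have "\<dots> = (\<Sum>k\<in>Poly_Mapping.keys \<alpha>. (c k)\<^sup>2 *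
      ((norm (w (\<alpha> - mi_unit k)))\<^sup>2 / fact (mi_deg (\<alpha> - mi_unit k))))"
    unfolding sum_divide_distrib using n by (intro sum.cong) (auto dest: mi_deg_diff_mi_unit)
  finally show "(norm (w \<alpha>))\<^sup>2 / fact (mi_deg \<alpha>)
    \<le> (\<Sum>k\<in>Poly_Mapping.keys \<alpha>. (c k)\<^sup>2 *
      ((norm (w (\<alpha> - mi_unit k)))\<^sup>2 / fact (mi_deg (\<alpha> - mi_unit k))))" .
qed simp_all

subsection \<open>Moments of the standard normal law and Hermite polynomials\<close>

text \<open>The moments of the standard normal law: (2m)! / (2^m m!) is the double factorial
  (2m-1)!!.\<close>

definition gauss_moment :: "nat \<Rightarrow> real" where
  "gauss_moment n = (if even n then fact n / (2 ^ (n div 2) * fact (n div 2)) else 0)"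

text \<open>Gaussian integration by parts for monomials. For \<open>n = 0\<close> the factor 0 makes
  the truncated index \<open>n - 1\<close> harmless.\<close>

lemma gauss_moment_Suc: "gauss_moment (Suc n) = real n * gauss_moment (n - 1)"
proof (cases "odd n")
  case True
  then obtain m where n: "n = 2 * m + 1"
    by (auto elim: oddE)
  have "fact (Suc (Suc (2 * m))) = (2 * real m + 2) * ((2 * real m + 1) * fact (2 * m))"
    by (simp add: algebra_simps)
  then have "gauss_moment (Suc n) = (2 * real m + 2) * ((2 * real m + 1) * fact (2 * m)) / (2 * 2 ^ m * ((real m + 1) * fact m))"
    by (simp add: gauss_moment_def n del: fact_Suc) (simp add: algebra_simps)
  also have "\<dots> = (2 * real m + 1) * fact (2 * m) / (2 ^ m * fact m)"
    by (simp add: divide_simps)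
  finally show ?thesis
    by (simp add: gauss_moment_def n)
qed (auto simp: gauss_moment_def)

text \<open>This is the moment identity for a combination of two independent standard normal
  variables with coefficients \<open>t\<close> and \<open>s\<close>. For odd n one of
  \<open>i\<close> and \<open>n - i\<close> is odd in every summand. For n = 2m only i = 2j
  survives, and the factorials collapse to the binomial theorem for the m-th power of t^2 +
  s^2.\<close>

lemma gauss_moment_convolution:
  fixes s t :: real
  shows "(\<Sum>i\<le>n. real (n choose i) * (gauss_moment i * (gauss_moment (n - i) * s ^ (n - i))) * t ^ i)
    = gauss_moment n * sqrt (t\<^sup>2 + s\<^sup>2) ^ n"
proof (cases "even n")
  case False
  then have "gauss_moment i * (gauss_moment (n - i) * s ^ (n - i)) = 0" if "i \<le> n" for i
    using that by (auto simp: gauss_moment_def)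
  then have "(\<Sum>i\<le>n. real (n choose i) * (gauss_moment i * (gauss_moment (n - i) * s ^ (n - i))) * t ^ i) = 0"
    by (intro sum.neutral) (metis atMost_iff mult_zero_left mult_zero_right)
  then show ?thesis
    using False by (simp add: gauss_moment_def)
next
  case True
  then obtain m where n: "n = 2 * m"
    by (auto elim: evenE)
  let ?f = "\<lambda>i. real (n choose i) * (gauss_moment i * (gauss_moment (n - i) * s ^ (n - i))) * t ^ i"
  have "sum ?f {..n} = sum ?f ((*) 2 ` {..m})"
  proof (intro sum.mono_neutral_right ballI)
    fix i assume i: "i \<in> {..n} - (*) 2 ` {..m}"
    have "odd i"
    proof
      assume "even i"
      then obtain j where "i = 2 * j"
        by (auto elim: evenE)
      with i n show False
        by auto
    qed
    then show "?f i = 0"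
      by (simp add: gauss_moment_def)
  qed (auto simp: n)
  also have "\<dots> = (\<Sum>j\<le>m. ?f (2 * j))"
    by (subst sum.reindex) (auto simp: inj_on_def)
  also have "\<dots> = (\<Sum>j\<le>m. gauss_moment n * (real (m choose j) * (t\<^sup>2) ^ j * (s\<^sup>2) ^ (m - j)))"
  proof (intro sum.cong refl)
    fix j assume "j \<in> {..m}"
    then have j: "j \<le> m"
      by simp
    define d where "d = m - j"
    have m: "m = j + d"
      using j by (simp add: d_def)
    have 1: "real (2 * m choose (2 * j)) = fact (2 * m) / (fact (2 * j) * fact (2 * d))"
      using binomial_fact[of "2 * j" "2 * m"] by (simp add: m)
    have 2: "real (m choose j) = fact m / (fact j * fact d)"
      using binomial_fact[of j m] by (simp add: m)
    have 3: "2 * m - 2 * j = 2 * d" "m - j = d"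
      by (simp_all add: m)
    have 4: "(2::real) ^ m = 2 ^ j * 2 ^ d"
      by (simp add: m power_add)
    show "?f (2 * j) = gauss_moment n * (real (m choose j) * (t\<^sup>2) ^ j * (s\<^sup>2) ^ (m - j))"
      unfolding n 3 by (simp add: gauss_moment_def 1 2 4 power_mult) (simp add: mult_ac)
  qed
  also have "\<dots> = gauss_moment n * (t\<^sup>2 + s\<^sup>2) ^ m"
    by (simp add: binomial_ring sum_distrib_left)
  finally show ?thesis
    by (simp add: n power_mult)
qed

text \<open>The expectation of a polynomial in a standard normal variable, encoded as a linear
  functional on coefficients so that Hermite orthogonality becomes pure algebra.\<close>

definition gauss_eval :: "real poly \<Rightarrow> real" where
  "gauss_eval p = (\<Sum>i\<le>degree p. coeff p i * gauss_moment i)"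

lemma gauss_eval_altdef:
  assumes "degree p \<le> n"
  shows "gauss_eval p = (\<Sum>i\<le>n. coeff p i * gauss_moment i)"
  unfolding gauss_eval_def using assms
  by (intro sum.mono_neutral_left) (auto simp: coeff_eq_0)

lemma gauss_eval_diff: "gauss_eval (p - q) = gauss_eval p - gauss_eval q"
proof -
  define n where "n = max (degree p) (degree q)"
  have "degree p \<le> n" "degree q \<le> n" "degree (p - q) \<le> n"
    by (auto simp: n_def intro: degree_diff_le_max)
  then show ?thesis
    by (simp add: gauss_eval_altdef sum_subtractf left_diff_distrib)
qed

lemma gauss_eval_smult: "gauss_eval (smult c p) = c * gauss_eval p"
  by (subst gauss_eval_altdef[of _ "degree p"])
    (auto simp: gauss_eval_def sum_distrib_left mult.assoc intro: degree_smult_le)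

text \<open>Gaussian integration by parts: \<open>pCons 0 p\<close> is x p(x). Coefficientwise it is
  the recursion for the moments.\<close>

lemma gauss_eval_pCons_0: "gauss_eval (pCons 0 p) = gauss_eval (pderiv p)"
proof -
  define n where "n = degree p"
  have "gauss_eval (pCons 0 p) = (\<Sum>i\<le>Suc n. coeff (pCons 0 p) i * gauss_moment i)"
    by (rule gauss_eval_altdef) (simp add: n_def degree_pCons_le)
  also have "\<dots> = (\<Sum>i\<le>n. coeff p i * gauss_moment (Suc i))"
    by (subst sum.atMost_Suc_shift) simp
  also have "\<dots> = (\<Sum>i\<le>Suc n. real i * coeff p i * gauss_moment (i - 1))"
    by (simp add: gauss_moment_Suc n_def coeff_eq_0 mult_ac)
  also have "\<dots> = (\<Sum>i\<le>n. real (Suc i) * coeff p (Suc i) * gauss_moment i)"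
    by (subst sum.atMost_Suc_shift) simp
  also have "\<dots> = gauss_eval (pderiv p)"
    by (subst gauss_eval_altdef[of _ n]) (auto simp: coeff_pderiv degree_pderiv n_def)
  finally show ?thesis .
qed

section \<open>Hermite polynomials and their orthogonality\<close>

primrec hermite_poly :: "nat \<Rightarrow> real poly" where
  "hermite_poly 0 = 1"
| "hermite_poly (Suc n) = pCons 0 (hermite_poly n) - pderiv (hermite_poly n)"

text \<open>One more derivative of H_n(y) exp(-y^2/2) yields minus (y H_n - H_n') times the same
  exponential, which is the recursion of \<open>hermite_poly\<close>. In the end both the signs and
  the exponentials cancel.\<close>

lemma hermite_eq_poly: "hermite n x = poly (hermite_poly n) x"
proof -
  have "(deriv ^^ n) (\<lambda>y::real. exp (- (y\<^sup>2) / 2))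
    = (\<lambda>y. (-1) ^ n * poly (hermite_poly n) y * exp (- (y\<^sup>2) / 2))"
  proof (induction n)
    case (Suc n)
    have "deriv (\<lambda>y. (-1) ^ n * poly (hermite_poly n) y * exp (- (y\<^sup>2) / 2)) x
      = (-1) ^ Suc n * poly (hermite_poly (Suc n)) x * exp (- (x\<^sup>2) / 2)" for x
      by (rule DERIV_imp_deriv) (auto intro!: derivative_eq_intros poly_DERIV simp: algebra_simps)
    then show ?case
      by (simp only: funpow.simps comp_apply Suc.IH)
  qed simp
  then show ?thesis
    by (simp add: hermite_def mult_ac flip: exp_add power_add mult_2)
qed

text \<open>Differentiating the recursion leaves H_n + x H_n' - H_n''. With H_n' = n H_{n-1}, the
  last two terms are n (x H_{n-1} - H_{n-1}') = n H_n.\<close>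

lemma pderiv_hermite_poly: "pderiv (hermite_poly n) = smult (real n) (hermite_poly (n - 1))"
proof (induction n)
  case 0
  show ?case
    by (simp add: pderiv_1)
next
  case (Suc n)
  show ?case
  proof (cases n)
    case 0
    then show ?thesis
      by (simp add: pderiv_1 pderiv_pCons pderiv_diff)
  next
    case (Suc m)
    have "pderiv (hermite_poly (Suc n))
      = hermite_poly n + pCons 0 (pderiv (hermite_poly n)) - pderiv (pderiv (hermite_poly n))"
      by (simp add: pderiv_diff pderiv_pCons)
    also have "\<dots> = hermite_poly n + smult (real n) (hermite_poly n)"
      unfolding Suc.IH pderiv_smult by (simp add: Suc smult_diff_right)
    also have "\<dots> = smult (real (Suc n)) (hermite_poly n)"
      by (simp add: smult_add_left)
    finally show ?thesis
      by simp
  qed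
qed

lemma pderiv_funpow_hermite_poly: "(pderiv ^^ n) (hermite_poly n) = [:fact n:]"
proof (induction n)
  case (Suc n)
  have "(pderiv ^^ Suc n) (hermite_poly (Suc n)) = (pderiv ^^ n) (smult (real (Suc n)) (hermite_poly n))"
    by (simp add: funpow_Suc_right pderiv_hermite_poly del: funpow.simps hermite_poly.simps)
  also have "\<dots> = smult (real (Suc n)) ((pderiv ^^ n) (hermite_poly n))"
    by (rule higher_pderiv_smult)
  finally show ?case
    by (simp add: Suc)
qed simp

text \<open>Each factor of the recursion for H_n moves one derivative to the other polynomial:
  integrating by parts, E[x H_n q] - E[H_n' q] = E[(H_n q)'] - E[H_n' q] = E[H_n q'].\<close>

lemma gauss_eval_hermite_poly_mult:
  "gauss_eval (hermite_poly n * q) = gauss_eval ((pderiv ^^ n) q)"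
proof (induction n arbitrary: q)
  case (Suc n)
  have "gauss_eval (hermite_poly (Suc n) * q)
      = gauss_eval (pderiv (hermite_poly n * q)) - gauss_eval (pderiv (hermite_poly n) * q)"
    by (simp add: left_diff_distrib gauss_eval_diff flip: gauss_eval_pCons_0)
  also have "\<dots> = gauss_eval (hermite_poly n * pderiv q)"
    by (simp add: pderiv_mult mult.commute flip: gauss_eval_diff)
  finally show ?case
    by (simp add: Suc funpow_Suc_right del: funpow.simps)
qed simp

text \<open>All derivatives of the Hermite polynomial of higher degree are moved to the other one,
  where they give 0 for unequal degrees and the constant n! for equal ones.\<close>

lemma hermite_poly_orthogonal:
  "gauss_eval (hermite_poly m * hermite_poly n) = (if m = n then fact n else 0)"
proof -
  have *: "gauss_eval (hermite_poly m * hermite_poly n) = 0" if "n < m" for m n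
  proof -
    obtain k where m: "m = Suc k + n"
      using less_imp_Suc_add[OF \<open>n < m\<close>] by (auto simp: add.commute)
    have "(pderiv ^^ m) (hermite_poly n) = (pderiv ^^ Suc k) [:fact n:]"
      by (simp only: m funpow_add comp_apply pderiv_funpow_hermite_poly)
    also have "\<dots> = (pderiv ^^ k) 0"
      by (simp add: funpow_Suc_right pderiv_pCons del: funpow.simps)
    also have "\<dots> = 0"
      by (induction k) auto
    finally show ?thesis
      unfolding gauss_eval_hermite_poly_mult by (simp add: gauss_eval_def)
  qed
  show ?thesis
  proof (cases m n rule: linorder_cases)
    case less
    then show ?thesis
      using *[OF less] by (simp add: mult.commute)
  next
    case equal
    then show ?thesis
      unfolding equal gauss_eval_hermite_poly_mult pderiv_funpow_hermite_poly
      by (simp add: gauss_eval_def gauss_moment_def)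
  next
    case greater
    then show ?thesis
      using *[OF greater] by simp
  qed
qed

subsection \<open>Random variables with moments of all orders\<close>

context prob_space
begin

text \<open>This class is closed under sums, products and polynomials; it supplies integrability for
  all polynomial expressions in Gaussian variables.\<close>

definition has_moments :: "('a \<Rightarrow> real) \<Rightarrow> bool" where
  "has_moments X \<longleftrightarrow> X \<in> borel_measurable M \<and> (\<forall>n. integrable M (\<lambda>\<omega>. X \<omega> ^ n))"

lemma has_moments_measurable: "has_moments X \<Longrightarrow> X \<in> borel_measurable M"
  by (simp add: has_moments_def)

lemma has_moments_integrable: "has_moments X \<Longrightarrow> integrable M X"
  unfolding has_moments_def by (metis (no_types, lifting) power_one_right Bochner_Integration.integrable_cong)

lemma has_moments_const: "has_moments (\<lambda>_. c)"
  by (simp add: has_moments_def)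

text \<open>The n-th power of the product is dominated by the sum of the two powers of order
  2n.\<close>

lemma has_moments_mult:
  assumes "has_moments X" "has_moments Y"
  shows "has_moments (\<lambda>\<omega>. X \<omega> * Y \<omega>)"
  unfolding has_moments_def
proof (intro conjI allI)
  have [measurable]: "X \<in> borel_measurable M" "Y \<in> borel_measurable M"
    using assms by (auto simp: has_moments_def)
  show "(\<lambda>\<omega>. X \<omega> * Y \<omega>) \<in> borel_measurable M"
    by measurable
  fix n
  show "integrable M (\<lambda>\<omega>. (X \<omega> * Y \<omega>) ^ n)"
  proof (rule Bochner_Integration.integrable_bound)
    show "integrable M (\<lambda>\<omega>. X \<omega> ^ (2 * n) + Y \<omega> ^ (2 * n))"
      using assms unfolding has_moments_def by (intro Bochner_Integration.integrable_add) blast+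
    have "\<bar>x * y\<bar> \<le> x\<^sup>2 + y\<^sup>2" for x y :: real
    proof -
      have "2 * (\<bar>x\<bar> * \<bar>y\<bar>) \<le> x\<^sup>2 + y\<^sup>2"
        using sum_squares_bound[of "\<bar>x\<bar>" "\<bar>y\<bar>"] by (simp add: mult.assoc)
      moreover have "0 \<le> \<bar>x\<bar> * \<bar>y\<bar>"
        by simp
      ultimately show ?thesis
        unfolding abs_mult by linarith
    qed
    from this[of "X _ ^ n" "Y _ ^ n"]
    show "AE \<omega> in M. norm ((X \<omega> * Y \<omega>) ^ n) \<le> norm (X \<omega> ^ (2 * n) + Y \<omega> ^ (2 * n))"
      by (auto simp: power_mult_distrib power_mult[symmetric] mult.commute intro: order_trans[OF _ abs_ge_self])
  qed measurable
qed

lemma has_moments_add: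
  assumes "has_moments X" "has_moments Y"
  shows "has_moments (\<lambda>\<omega>. X \<omega> + Y \<omega>)"
  unfolding has_moments_def
proof (intro conjI allI)
  have [measurable]: "X \<in> borel_measurable M" "Y \<in> borel_measurable M"
    using assms by (auto simp: has_moments_def)
  show "(\<lambda>\<omega>. X \<omega> + Y \<omega>) \<in> borel_measurable M"
    by measurable
  have pow: "has_moments (\<lambda>\<omega>. Z \<omega> ^ k)" if "has_moments Z" for Z and k :: nat
    using that by (induction k) (auto intro: has_moments_const has_moments_mult)
  fix n
  have "integrable M (\<lambda>\<omega>. \<Sum>k\<le>n. real (n choose k) * (X \<omega> ^ k * Y \<omega> ^ (n - k)))"
    by (intro Bochner_Integration.integrable_sum integrable_mult_right has_moments_integrable
        has_moments_mult pow assms)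
  then show "integrable M (\<lambda>\<omega>. (X \<omega> + Y \<omega>) ^ n)"
    by (simp add: binomial_ring mult.assoc)
qed

lemma has_moments_power: "has_moments X \<Longrightarrow> has_moments (\<lambda>\<omega>. X \<omega> ^ n)"
  by (induction n) (auto intro: has_moments_const has_moments_mult)

lemma has_moments_sum:
  "finite S \<Longrightarrow> (\<And>k. k \<in> S \<Longrightarrow> has_moments (X k)) \<Longrightarrow> has_moments (\<lambda>\<omega>. \<Sum>k\<in>S. X k \<omega>)"
  by (induction S rule: finite_induct) (auto intro: has_moments_const has_moments_add)

lemma has_moments_prod:
  "finite S \<Longrightarrow> (\<And>k. k \<in> S \<Longrightarrow> has_moments (X k)) \<Longrightarrow> has_moments (\<lambda>\<omega>. \<Prod>k\<in>S. X k \<omega>)"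
  by (induction S rule: finite_induct) (auto intro: has_moments_const has_moments_mult)

lemma has_moments_poly: "has_moments X \<Longrightarrow> has_moments (\<lambda>\<omega>. poly p (X \<omega>))"
  by (induction p) (auto intro!: has_moments_const has_moments_add has_moments_mult)

text \<open>The expectation becomes a polynomial in \<open>t\<close> whose coefficients are the
  mixed moments, so an identity valid for all \<open>t\<close> can be read off coefficient by
  coefficient.\<close>

lemma expectation_mult_binomial:
  assumes "has_moments F" "has_moments X" "has_moments Y"
  shows "expectation (\<lambda>\<omega>. F \<omega> * (t * X \<omega> + Y \<omega>) ^ n)
    = (\<Sum>i\<le>n. real (n choose i) * expectation (\<lambda>\<omega>. F \<omega> * X \<omega> ^ i * Y \<omega> ^ (n - i)) * t ^ i)"
proof -
  have "expectation (\<lambda>\<omega>. F \<omega> * (t * X \<omega> + Y \<omega>) ^ n)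
    = expectation (\<lambda>\<omega>. \<Sum>i\<le>n. (real (n choose i) * t ^ i) * (F \<omega> * X \<omega> ^ i * Y \<omega> ^ (n - i)))"
    by (simp add: binomial_ring power_mult_distrib sum_distrib_left mult_ac)
  also have "\<dots> = (\<Sum>i\<le>n. (real (n choose i) * t ^ i) * expectation (\<lambda>\<omega>. F \<omega> * X \<omega> ^ i * Y \<omega> ^ (n - i)))"
    by (subst Bochner_Integration.integral_sum)
      (auto intro!: integrable_mult_right has_moments_integrable has_moments_mult has_moments_power assms)
  finally show ?thesis
    by (simp add: mult_ac)
qed

lemma normal_distributed_moments:
  assumes "0 < \<sigma>" and D: "distributed M lborel X (\<lambda>x. ennreal (normal_density 0 \<sigma> x))"
  shows "integrable M (\<lambda>\<omega>. X \<omega> ^ n)" "expectation (\<lambda>\<omega>. X \<omega> ^ n) = gauss_moment n * \<sigma> ^ n"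
proof -
  have *: "has_bochner_integral lborel (\<lambda>x. normal_density 0 \<sigma> x * x ^ n) (gauss_moment n * \<sigma> ^ n)"
  proof (cases "even n")
    case True
    then obtain k where "n = 2 * k"
      by (auto elim: evenE)
    then show ?thesis
      using normal_moment_even[OF \<open>0 < \<sigma>\<close>, of 0 k] \<open>0 < \<sigma>\<close>
      by (simp add: gauss_moment_def power_divide power_mult[symmetric] field_simps)
  next
    case False
    then obtain k where "n = 2 * k + 1"
      by (auto elim: oddE)
    then show ?thesis
      using normal_moment_odd[OF \<open>0 < \<sigma>\<close>, of 0 k] by (simp add: gauss_moment_def)
  qed
  show "integrable M (\<lambda>\<omega>. X \<omega> ^ n)"
    using distributed_integrable[OF D, of "\<lambda>x. x ^ n"] * by (auto simp: has_bochner_integral_iff)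
  show "expectation (\<lambda>\<omega>. X \<omega> ^ n) = gauss_moment n * \<sigma> ^ n"
    using distributed_integral[OF D, of "\<lambda>x. x ^ n"] * by (auto simp: has_bochner_integral_iff)
qed

text \<open>Writing the standard deviation as the root of the second moment covers the point mass at
  0 as well; there the convention 0^0 = 1 gives the case \<open>n = 0\<close>.\<close>

lemma centered_gaussian_moments:
  assumes "centered_gaussian M X"
  shows "has_moments X"
    and "expectation (\<lambda>\<omega>. X \<omega> ^ n) = gauss_moment n * sqrt (expectation (\<lambda>\<omega>. (X \<omega>)\<^sup>2)) ^ n"
proof -
  have [measurable]: "X \<in> borel_measurable M"
    using assms by (simp add: centered_gaussian_def)
  consider "AE \<omega> in M. X \<omega> = 0"
    | \<sigma> where "\<sigma> > 0" "distributed M lborel X (\<lambda>x. ennreal (normal_density 0 \<sigma> x))"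
    using assms unfolding centered_gaussian_def by blast
  then have "has_moments X \<and>
    expectation (\<lambda>\<omega>. X \<omega> ^ n) = gauss_moment n * sqrt (expectation (\<lambda>\<omega>. (X \<omega>)\<^sup>2)) ^ n"
  proof cases
    case 1
    have "integrable M (\<lambda>\<omega>. X \<omega> ^ k) \<and> expectation (\<lambda>\<omega>. X \<omega> ^ k) = 0 ^ k" for k
    proof -
      have ae: "AE \<omega> in M. X \<omega> ^ k = 0 ^ k"
        using 1 by eventually_elim simp
      have "integrable M (\<lambda>\<omega>. X \<omega> ^ k) \<longleftrightarrow> integrable M (\<lambda>_. 0 ^ k :: real)"
        using ae by (intro integrable_cong_AE) auto
      moreover have "expectation (\<lambda>\<omega>. X \<omega> ^ k) = expectation (\<lambda>_. 0 ^ k :: real)"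
        using ae by (intro integral_cong_AE) auto
      ultimately show ?thesis
        by (simp add: prob_space)
    qed
    note this[of n] this[of 2] this
    then show ?thesis
      unfolding has_moments_def by (cases "n = 0") (auto simp: gauss_moment_def power_0_left)
  next
    case 2
    note m = normal_distributed_moments[OF 2]
    have "expectation (\<lambda>\<omega>. (X \<omega>)\<^sup>2) = \<sigma>\<^sup>2"
      using m(2)[of 2] by (simp add: gauss_moment_def)
    then show ?thesis
      using m \<open>\<sigma> > 0\<close> by (simp add: has_moments_def)
  qed
  then show "has_moments X"
    and "expectation (\<lambda>\<omega>. X \<omega> ^ n) = gauss_moment n * sqrt (expectation (\<lambda>\<omega>. (X \<omega>)\<^sup>2)) ^ n"
    by auto
qed

end

subsection \<open>Mixed moments of orthonormal Gaussian sequences\<close>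

text \<open>Joint normality is expressed by the laws of finite linear combinations. In place of
  independence, the factorisation of mixed moments is derived from it.\<close>

locale orthonormal_gaussian_sequence = prob_space M for M :: "'a measure" +
  fixes X :: "nat \<Rightarrow> 'a \<Rightarrow> real"
  assumes gaussian: "finite S \<Longrightarrow> centered_gaussian M (\<lambda>\<omega>. \<Sum>k\<in>S. c k * X k \<omega>)"
    and orthonormal: "expectation (\<lambda>\<omega>. X j \<omega> * X k \<omega>) = (if j = k then 1 else 0)"
begin

lemma has_moments_lincomb: "finite S \<Longrightarrow> has_moments (\<lambda>\<omega>. \<Sum>k\<in>S. c k * X k \<omega>)"
  by (rule centered_gaussian_moments(1)[OF gaussian])

lemma has_moments_X: "has_moments (X k)"
  using has_moments_lincomb[of "{k}" "\<lambda>_. 1"] by simp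

lemma lincomb_variance:
  assumes "finite S"
  shows "expectation (\<lambda>\<omega>. (\<Sum>k\<in>S. c k * X k \<omega>)\<^sup>2) = (\<Sum>k\<in>S. (c k)\<^sup>2)"
proof -
  have int: "integrable M (\<lambda>\<omega>. X j \<omega> * X k \<omega>)" for j k
    by (intro has_moments_integrable has_moments_mult has_moments_X)
  have "expectation (\<lambda>\<omega>. (\<Sum>k\<in>S. c k * X k \<omega>)\<^sup>2)
    = expectation (\<lambda>\<omega>. \<Sum>j\<in>S. \<Sum>k\<in>S. c j * c k * (X j \<omega> * X k \<omega>))"
    by (simp add: power2_eq_square sum_product mult_ac)
  also have "\<dots> = (\<Sum>j\<in>S. \<Sum>k\<in>S. c j * c k * expectation (\<lambda>\<omega>. X j \<omega> * X k \<omega>))"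
    by (simp add: Bochner_Integration.integral_sum int)
  also have "\<dots> = (\<Sum>k\<in>S. (c k)\<^sup>2)"
    using assms by (simp add: orthonormal power2_eq_square if_distrib sum.delta cong: if_cong)
  finally show ?thesis .
qed

lemma lincomb_moment:
  assumes "finite S"
  shows "expectation (\<lambda>\<omega>. (\<Sum>k\<in>S. c k * X k \<omega>) ^ n) = gauss_moment n * sqrt (\<Sum>k\<in>S. (c k)\<^sup>2) ^ n"
  using centered_gaussian_moments(2)[OF gaussian[OF assms], where n = n and c1 = c] lincomb_variance[OF assms]
  by simp

lemma lincomb_insert:
  assumes "finite S" "l \<notin> S"
  shows "(\<Sum>k\<in>insert l S. (c(l := t)) k * X k \<omega>) = t * X l \<omega> + (\<Sum>k\<in>S. c k * X k \<omega>)"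
proof -
  have "(\<Sum>k\<in>S. (c(l := t)) k * X k \<omega>) = (\<Sum>k\<in>S. c k * X k \<omega>)"
    using assms by (intro sum.cong) auto
  then show ?thesis
    using assms by simp
qed

text \<open>For every \<open>t\<close> the combination of \<open>X l\<close> with coefficient
  \<open>t\<close> and the given sum is centred Gaussian with variance t^2 + s^2. Its moment of
  order \<open>a + b\<close> is a polynomial in \<open>t\<close>, and the coefficient of t^a gives
  the claim after division by a positive binomial coefficient.\<close>

lemma expectation_power_mult_lincomb:
  assumes "finite S" "l \<notin> S"
  shows "expectation (\<lambda>\<omega>. X l \<omega> ^ a * (\<Sum>k\<in>S. c k * X k \<omega>) ^ b)
    = gauss_moment a * expectation (\<lambda>\<omega>. (\<Sum>k\<in>S. c k * X k \<omega>) ^ b)"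
proof -
  let ?Y = "\<lambda>\<omega>. \<Sum>k\<in>S. c k * X k \<omega>"
  define n where "n = a + b"
  define s where "s = sqrt (\<Sum>k\<in>S. (c k)\<^sup>2)"
  have s2: "s\<^sup>2 = (\<Sum>k\<in>S. (c k)\<^sup>2)"
    unfolding s_def by (simp add: sum_nonneg)
  have "(\<Sum>i\<le>n. real (n choose i) * expectation (\<lambda>\<omega>. 1 * X l \<omega> ^ i * ?Y \<omega> ^ (n - i)) * t ^ i)
    = (\<Sum>i\<le>n. real (n choose i) * (gauss_moment i * (gauss_moment (n - i) * s ^ (n - i))) * t ^ i)" for t
  proof -
    have "(\<Sum>i\<le>n. real (n choose i) * expectation (\<lambda>\<omega>. 1 * X l \<omega> ^ i * ?Y \<omega> ^ (n - i)) * t ^ i)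
        = expectation (\<lambda>\<omega>. 1 * (t * X l \<omega> + ?Y \<omega>) ^ n)"
      using assms by (intro expectation_mult_binomial[symmetric] has_moments_const has_moments_X has_moments_lincomb)
    also have "\<dots> = expectation (\<lambda>\<omega>. (\<Sum>k\<in>insert l S. (c(l := t)) k * X k \<omega>) ^ n)"
      by (simp only: lincomb_insert[OF assms] mult_1)
    also have "\<dots> = gauss_moment n * sqrt (\<Sum>k\<in>insert l S. ((c(l := t)) k)\<^sup>2) ^ n"
      using assms by (intro lincomb_moment) auto
    also have "(\<Sum>k\<in>insert l S. ((c(l := t)) k)\<^sup>2) = t\<^sup>2 + s\<^sup>2"
      unfolding s2 using assms by (auto intro!: sum.cong)
    also have "gauss_moment n * sqrt (t\<^sup>2 + s\<^sup>2) ^ n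
      = (\<Sum>i\<le>n. real (n choose i) * (gauss_moment i * (gauss_moment (n - i) * s ^ (n - i))) * t ^ i)"
      by (rule gauss_moment_convolution[symmetric])
    finally show ?thesis .
  qed
  then have "\<forall>i\<le>n. real (n choose i) * expectation (\<lambda>\<omega>. 1 * X l \<omega> ^ i * ?Y \<omega> ^ (n - i))
      = real (n choose i) * (gauss_moment i * (gauss_moment (n - i) * s ^ (n - i)))"
    by (subst polyfun_eq_coeffs[symmetric]) blast
  from this[rule_format, of a] show ?thesis
    by (simp add: n_def lincomb_moment[OF assms(1)] s_def)
qed

text \<open>Mixed moments factorise because both sides are determined by the one-dimensional laws of the
  linear combinations: compare the coefficients of the powers of \<open>t\<close> in the moments of
  \<open>t X\<^sub>l + \<Sum>k\<in>S. c\<^sub>k X\<^sub>k\<close>.\<close>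

lemma expectation_prod_poly_mult_lincomb:
  assumes "finite T" "finite S" "T \<inter> S = {}"
  shows "expectation (\<lambda>\<omega>. (\<Prod>k\<in>T. poly (p k) (X k \<omega>)) * (\<Sum>k\<in>S. c k * X k \<omega>) ^ b)
    = (\<Prod>k\<in>T. gauss_eval (p k)) * expectation (\<lambda>\<omega>. (\<Sum>k\<in>S. c k * X k \<omega>) ^ b)"
  using assms
proof (induction T arbitrary: S c b rule: finite_induct)
  case empty
  show ?case
    by simp
next
  case (insert l T)
  let ?Y = "\<lambda>\<omega>. \<Sum>k\<in>S. c k * X k \<omega>"
  let ?F = "\<lambda>\<omega>. \<Prod>k\<in>T. poly (p k) (X k \<omega>)"
  let ?g = "\<Prod>k\<in>T. gauss_eval (p k)"
  have S: "finite S" "l \<notin> S" and disj: "T \<inter> insert l S = {}"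
    using insert by auto
  have F: "has_moments ?F" and Y: "has_moments ?Y"
    using insert.hyps S by (auto intro!: has_moments_prod has_moments_poly has_moments_X has_moments_lincomb)
  have power: "expectation (\<lambda>\<omega>. ?F \<omega> * X l \<omega> ^ a * ?Y \<omega> ^ b)
      = ?g * (gauss_moment a * expectation (\<lambda>\<omega>. ?Y \<omega> ^ b))" for a
  proof -
    define n where "n = a + b"
    have "(\<Sum>i\<le>n. real (n choose i) * expectation (\<lambda>\<omega>. ?F \<omega> * X l \<omega> ^ i * ?Y \<omega> ^ (n - i)) * t ^ i)
      = (\<Sum>i\<le>n. ?g * (real (n choose i) * expectation (\<lambda>\<omega>. 1 * X l \<omega> ^ i * ?Y \<omega> ^ (n - i))) * t ^ i)" for t
    proof -
      have "(\<Sum>i\<le>n. real (n choose i) * expectation (\<lambda>\<omega>. ?F \<omega> * X l \<omega> ^ i * ?Y \<omega> ^ (n - i)) * t ^ i)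
          = expectation (\<lambda>\<omega>. ?F \<omega> * (t * X l \<omega> + ?Y \<omega>) ^ n)"
        by (intro expectation_mult_binomial[symmetric] F Y has_moments_X)
      \<comment> \<open>The induction hypothesis is used for the enlarged set
        \<open>insert l S\<close> with coefficient \<open>t\<close> at \<open>l\<close>; hence the
        generalisation over \<open>S\<close>, \<open>c\<close> and \<open>b\<close>.\<close>
      also have "\<dots> = ?g * expectation (\<lambda>\<omega>. 1 * (t * X l \<omega> + ?Y \<omega>) ^ n)"
        using insert.IH[of "insert l S" "c(l := t)" n] disj S by (simp only: lincomb_insert[OF S] mult_1) simp
      also have "\<dots> = ?g * (\<Sum>i\<le>n. real (n choose i) * expectation (\<lambda>\<omega>. 1 * X l \<omega> ^ i * ?Y \<omega> ^ (n - i)) * t ^ i)"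
        by (subst expectation_mult_binomial) (auto intro: has_moments_const Y has_moments_X)
      finally show ?thesis
        by (simp only: sum_distrib_left mult.assoc)
    qed
    then have "\<forall>i\<le>n. real (n choose i) * expectation (\<lambda>\<omega>. ?F \<omega> * X l \<omega> ^ i * ?Y \<omega> ^ (n - i))
        = ?g * (real (n choose i) * expectation (\<lambda>\<omega>. 1 * X l \<omega> ^ i * ?Y \<omega> ^ (n - i)))"
      by (subst polyfun_eq_coeffs[symmetric]) blast
    from this[rule_format, of a] have "expectation (\<lambda>\<omega>. ?F \<omega> * X l \<omega> ^ a * ?Y \<omega> ^ b)
        = ?g * expectation (\<lambda>\<omega>. X l \<omega> ^ a * ?Y \<omega> ^ b)"
      by (simp add: n_def)
    then show ?thesis
      by (simp only: expectation_power_mult_lincomb[OF S])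
  qed
  have "expectation (\<lambda>\<omega>. (\<Prod>k\<in>insert l T. poly (p k) (X k \<omega>)) * ?Y \<omega> ^ b)
    = expectation (\<lambda>\<omega>. \<Sum>a\<le>degree (p l). coeff (p l) a * (?F \<omega> * X l \<omega> ^ a * ?Y \<omega> ^ b))"
    using insert.hyps by (simp add: poly_altdef[of "p l"] sum_distrib_right sum_distrib_left mult_ac)
  also have "\<dots> = (\<Sum>a\<le>degree (p l). coeff (p l) a * expectation (\<lambda>\<omega>. ?F \<omega> * X l \<omega> ^ a * ?Y \<omega> ^ b))"
    by (subst Bochner_Integration.integral_sum)
      (auto intro!: integrable_mult_right has_moments_integrable has_moments_mult has_moments_power F Y has_moments_X)
  also have "\<dots> = gauss_eval (p l) * ?g * expectation (\<lambda>\<omega>. ?Y \<omega> ^ b)"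
    unfolding power gauss_eval_def sum_distrib_right by (simp add: mult_ac)
  finally show ?case
    using insert.hyps by simp
qed

lemma expectation_prod_poly:
  assumes "finite T"
  shows "expectation (\<lambda>\<omega>. \<Prod>k\<in>T. poly (p k) (X k \<omega>)) = (\<Prod>k\<in>T. gauss_eval (p k))"
  using expectation_prod_poly_mult_lincomb[of T "{}" p "\<lambda>_. 0" 0] assms by (simp add: prob_space)

end

subsection \<open>Random series over an orthonormal system\<close>

lemma summable_on_small_tail:
  fixes g :: "'i \<Rightarrow> real"
  assumes g: "g summable_on UNIV" "\<And>\<alpha>. g \<alpha> \<ge> 0" and "\<epsilon> > 0"
  obtains F where "finite F" "\<And>G. finite G \<Longrightarrow> G \<inter> F = {} \<Longrightarrow> sum g G \<le> \<epsilon>"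
proof -
  have "(sum g \<longlongrightarrow> infsum g UNIV) (finite_subsets_at_top UNIV)"
    using has_sum_infsum[OF g(1)] by (simp add: has_sum_def)
  then have "\<forall>\<^sub>F F in finite_subsets_at_top UNIV. dist (sum g F) (infsum g UNIV) < \<epsilon>"
    using \<open>\<epsilon> > 0\<close> by (rule tendstoD)
  then obtain F where F: "finite F" "dist (sum g F) (infsum g UNIV) < \<epsilon>"
    unfolding eventually_finite_subsets_at_top by auto
  have "sum g G \<le> \<epsilon>" if G: "finite G" "G \<inter> F = {}" for G
  proof -
    have "sum g G + sum g F = sum g (G \<union> F)"
      using F G by (simp add: sum.union_disjoint)
    also have "\<dots> \<le> infsum g UNIV"
      using F G g by (intro finite_sum_le_infsum) auto
    finally show ?thesis
      using F(2) by (simp add: dist_real_def)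
  qed
  with F(1) show ?thesis
    by (rule that)
qed

lemma Cauchy_if_summable_dist:
  fixes s :: "nat \<Rightarrow> 'b :: metric_space"
  assumes "summable (\<lambda>n. dist (s n) (s (Suc n)))"
  shows "Cauchy s"
proof (rule metric_CauchyI)
  let ?t = "\<lambda>n. \<Sum>k<n. dist (s k) (s (Suc k))"
  fix \<epsilon> :: real assume "\<epsilon> > 0"
  have "Cauchy ?t"
    using assms by (intro convergent_Cauchy) (simp add: summable_iff_convergent)
  then obtain N where N: "\<And>m n. m \<ge> N \<Longrightarrow> n \<ge> N \<Longrightarrow> dist (?t m) (?t n) < \<epsilon>"
    using metric_CauchyD[OF _ \<open>\<epsilon> > 0\<close>] by blast
  have le: "dist (s m) (s n) \<le> ?t n - ?t m" if "m \<le> n" for m n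
    using that
  proof (induction n rule: dec_induct)
    case (step n)
    then show ?case
      using dist_triangle[of "s m" "s (Suc n)" "s n"] by simp
  qed simp
  have "dist (s m) (s n) < \<epsilon>" if "m \<ge> N" "n \<ge> N" for m n
  proof (cases "m \<le> n")
    case True
    then show ?thesis
      using le[OF True] N[OF that] by (simp add: dist_real_def)
  next
    case False
    then show ?thesis
      using le[of n m] N[OF that] by (simp add: dist_real_def dist_commute)
  qed
  then show "\<exists>M. \<forall>m\<ge>M. \<forall>n\<ge>M. dist (s m) (s n) < \<epsilon>"
    by blast
qed

text \<open>The values may lie in a non-separable space, where sums and limits of Borel functions need not
  be Borel; the finite sums are nevertheless limits of simple functions.\<close>

lemma borel_measurable_sum_scaleR_const:
  fixes v :: "'i \<Rightarrow> 'v :: real_normed_vector"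
  assumes "\<And>\<alpha>. \<xi> \<alpha> \<in> borel_measurable M"
  shows "(\<lambda>\<omega>. \<Sum>\<alpha>\<in>F. \<xi> \<alpha> \<omega> *\<^sub>R v \<alpha>) \<in> borel_measurable M"
proof -
  have "\<exists>s. (\<forall>i. simple_function M (s i)) \<and> (\<forall>\<omega>\<in>space M. (\<lambda>i. s i \<omega>) \<longlonglongrightarrow> \<xi> \<alpha> \<omega>)" for \<alpha>
    using borel_measurable_implies_sequence_metric[OF assms[of \<alpha>], of 0] by blast
  then obtain s where s: "\<And>\<alpha> i. simple_function M (s \<alpha> i)"
      "\<And>\<alpha> \<omega>. \<omega> \<in> space M \<Longrightarrow> (\<lambda>i. s \<alpha> i \<omega>) \<longlonglongrightarrow> \<xi> \<alpha> \<omega>"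
    by metis
  show ?thesis
  proof (rule borel_measurable_LIMSEQ_metric)
    show "(\<lambda>\<omega>. \<Sum>\<alpha>\<in>F. s \<alpha> i \<omega> *\<^sub>R v \<alpha>) \<in> borel_measurable M" for i
      by (intro borel_measurable_simple_function simple_function_sum
          simple_function_compose1[OF s(1), where g = "\<lambda>x. x *\<^sub>R v _"])
    show "(\<lambda>i. \<Sum>\<alpha>\<in>F. s \<alpha> i \<omega> *\<^sub>R v \<alpha>) \<longlonglongrightarrow> (\<Sum>\<alpha>\<in>F. \<xi> \<alpha> \<omega> *\<^sub>R v \<alpha>)" if "\<omega> \<in> space M" for \<omega>
      by (intro tendsto_intros s that)
  qed
qed

section \<open>Almost sure and mean-square sums over an orthonormal system\<close>

locale orthonormal_system = prob_space M for M :: "'a measure" +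
  fixes \<xi> :: "'i \<Rightarrow> 'a \<Rightarrow> real"
  assumes \<xi>_measurable [measurable]: "\<xi> \<alpha> \<in> borel_measurable M"
    and \<xi>_integrable: "integrable M (\<lambda>\<omega>. \<xi> \<alpha> \<omega> * \<xi> \<beta> \<omega>)"
    and \<xi>_orthonormal: "expectation (\<lambda>\<omega>. \<xi> \<alpha> \<omega> * \<xi> \<beta> \<omega>) = (if \<alpha> = \<beta> then 1 else 0)"
begin

definition psum :: "('i \<Rightarrow> 'v :: real_normed_vector) \<Rightarrow> 'i set \<Rightarrow> 'a \<Rightarrow> 'v" where
  "psum v F \<omega> = (\<Sum>\<alpha>\<in>F. \<xi> \<alpha> \<omega> *\<^sub>R v \<alpha>)"

lemma psum_measurable [measurable]: "psum v F \<in> borel_measurable M"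
  unfolding psum_def[abs_def] by (rule borel_measurable_sum_scaleR_const) simp

lemma nn_integral_psum:
  fixes v :: "'i \<Rightarrow> 'v :: real_inner"
  assumes "finite F"
  shows "(\<integral>\<^sup>+\<omega>. ennreal ((norm (psum v F \<omega>))\<^sup>2) \<partial>M) = ennreal (\<Sum>\<alpha>\<in>F. (norm (v \<alpha>))\<^sup>2)"
proof -
  have eq: "(norm (psum v F \<omega>))\<^sup>2 = (\<Sum>\<alpha>\<in>F. \<Sum>\<beta>\<in>F. (v \<alpha> \<bullet> v \<beta>) * (\<xi> \<alpha> \<omega> * \<xi> \<beta> \<omega>))" for \<omega>
    by (simp add: psum_def power2_norm_eq_inner inner_sum_left inner_sum_right sum_distrib_left inner_commute mult_ac)
  have "integrable M (\<lambda>\<omega>. (norm (psum v F \<omega>))\<^sup>2)"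
    unfolding eq by (intro Bochner_Integration.integrable_sum integrable_mult_right \<xi>_integrable)
  then have "(\<integral>\<^sup>+\<omega>. ennreal ((norm (psum v F \<omega>))\<^sup>2) \<partial>M) = ennreal (expectation (\<lambda>\<omega>. (norm (psum v F \<omega>))\<^sup>2))"
    by (intro nn_integral_eq_integral) auto
  also have "expectation (\<lambda>\<omega>. (norm (psum v F \<omega>))\<^sup>2)
      = (\<Sum>\<alpha>\<in>F. \<Sum>\<beta>\<in>F. (v \<alpha> \<bullet> v \<beta>) * expectation (\<lambda>\<omega>. \<xi> \<alpha> \<omega> * \<xi> \<beta> \<omega>))"
    unfolding eq by (simp add: Bochner_Integration.integral_sum \<xi>_integrable)
  also have "\<dots> = (\<Sum>\<alpha>\<in>F. (norm (v \<alpha>))\<^sup>2)"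
    using assms by (simp add: \<xi>_orthonormal power2_norm_eq_inner if_distrib sum.delta cong: if_cong)
  finally show ?thesis .
qed

text \<open>Fatou's lemma along the sequence \<open>S\<close>. No measurability of \<open>X\<close>
  is demanded because the bound is applied to remainders, which need not be Borel in a non-separable
  space.\<close>

lemma nn_integral_limit_le:
  fixes v :: "'i \<Rightarrow> 'v :: real_inner"
  assumes S: "\<And>k. finite (S k)"
    and lim: "AE \<omega> in M. (\<lambda>k. psum v (S k) \<omega>) \<longlonglongrightarrow> X \<omega>"
    and K: "\<And>F. finite F \<Longrightarrow> (\<Sum>\<alpha>\<in>F. (norm (v \<alpha>))\<^sup>2) \<le> K"
  shows "(\<integral>\<^sup>+\<omega>. ennreal ((norm (X \<omega>))\<^sup>2) \<partial>M) \<le> ennreal K"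
proof -
  let ?g = "\<lambda>k \<omega>. ennreal ((norm (psum v (S k) \<omega>))\<^sup>2)"
  have "AE \<omega> in M. ennreal ((norm (X \<omega>))\<^sup>2) \<le> liminf (\<lambda>k. ?g k \<omega>)"
    using lim
  proof eventually_elim
    case (elim \<omega>)
    then have "(\<lambda>k. ?g k \<omega>) \<longlonglongrightarrow> ennreal ((norm (X \<omega>))\<^sup>2)"
      by (intro tendsto_ennrealI tendsto_intros)
    then show ?case
      by (subst lim_imp_Liminf) auto
  qed
  then have "(\<integral>\<^sup>+\<omega>. ennreal ((norm (X \<omega>))\<^sup>2) \<partial>M) \<le> (\<integral>\<^sup>+\<omega>. liminf (\<lambda>k. ?g k \<omega>) \<partial>M)"
    by (rule nn_integral_mono_AE)
  also have "\<dots> \<le> liminf (\<lambda>k. \<integral>\<^sup>+\<omega>. ?g k \<omega> \<partial>M)"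
    by (rule nn_integral_liminf) measurable
  also have "\<dots> \<le> ennreal K"
    using K S by (intro Liminf_le) (auto simp: nn_integral_psum intro!: ennreal_leI always_eventually)
  finally show ?thesis .
qed

text \<open>The increments have mean squares at most K / 4^k. After multiplication by 2^k these are
  still summable, which forces the norms of the increments to be summable almost surely.\<close>

lemma psum_convergent_AE:
  fixes v :: "'i \<Rightarrow> 'v :: {real_inner, complete_space}"
  assumes S: "\<And>k. finite (S k)" "incseq S"
    and K: "\<And>k F. finite F \<Longrightarrow> F \<inter> S k = {} \<Longrightarrow> (\<Sum>\<alpha>\<in>F. (norm (v \<alpha>))\<^sup>2) \<le> K / 4 ^ k"
  obtains X where "X \<in> borel_measurable M" "AE \<omega> in M. (\<lambda>k. psum v (S k) \<omega>) \<longlonglongrightarrow> X \<omega>"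
proof -
  define D where "D k = psum v (S (Suc k) - S k)" for k
  have D: "psum v (S (Suc k)) \<omega> = psum v (S k) \<omega> + D k \<omega>" for k \<omega>
    unfolding D_def psum_def
    using S by (subst sum.subset_diff[of "S k"]) (auto simp: incseq_SucD add.commute)
  have [measurable]: "D k \<in> borel_measurable M" for k
    unfolding D_def by simp
  define g where "g \<omega> = suminf (\<lambda>k. ennreal (2 ^ k * (norm (D k \<omega>))\<^sup>2))" for \<omega>
  have [measurable]: "g \<in> borel_measurable M"
    unfolding g_def by measurable
  have "K \<ge> 0"
    using K[of "{}" 0] by simp
  have "(\<integral>\<^sup>+\<omega>. g \<omega> \<partial>M) = suminf (\<lambda>k. \<integral>\<^sup>+\<omega>. ennreal (2 ^ k * (norm (D k \<omega>))\<^sup>2) \<partial>M)"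
    unfolding g_def by (rule nn_integral_suminf) measurable
  also have "\<dots> \<le> suminf (\<lambda>k. ennreal (K * (1 / 2) ^ k))"
  proof (rule suminf_le)
    fix k
    have "(\<integral>\<^sup>+\<omega>. ennreal (2 ^ k * (norm (D k \<omega>))\<^sup>2) \<partial>M) = ennreal (2 ^ k) * (\<integral>\<^sup>+\<omega>. ennreal ((norm (D k \<omega>))\<^sup>2) \<partial>M)"
      by (simp add: ennreal_mult' nn_integral_cmult)
    also have "\<dots> = ennreal (2 ^ k * (\<Sum>\<alpha>\<in>S (Suc k) - S k. (norm (v \<alpha>))\<^sup>2))"
      unfolding D_def using S(1) by (simp add: nn_integral_psum ennreal_mult' sum_nonneg)
    also have "\<dots> \<le> ennreal (2 ^ k * (K / 4 ^ k))"
      using S(1) by (intro ennreal_leI mult_left_mono K) auto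
    also have "2 ^ k * (K / 4 ^ k) = K * (1 / 2) ^ k"
      using power_mult_distrib[of "2::real" 2 k] by (simp add: power_divide field_simps)
    finally show "(\<integral>\<^sup>+\<omega>. ennreal (2 ^ k * (norm (D k \<omega>))\<^sup>2) \<partial>M) \<le> ennreal (K * (1 / 2) ^ k)" .
  qed auto
  also have "\<dots> = ennreal (K * 2)"
    using \<open>K \<ge> 0\<close> sums_mult[OF geometric_sums[of "1 / 2 :: real"], of K] by (intro suminf_ennreal_eq) auto
  finally have "(\<integral>\<^sup>+\<omega>. g \<omega> \<partial>M) \<noteq> \<infinity>"
    by (auto simp: top_unique)
  then have AE: "AE \<omega> in M. g \<omega> \<noteq> \<infinity>"
    by (rule nn_integral_PInf_AE[rotated]) measurable
  have conv: "convergent (\<lambda>k. psum v (S k) \<omega>)" if "g \<omega> \<noteq> \<infinity>" for \<omega>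
  proof (intro Cauchy_convergent Cauchy_if_summable_dist)
    have "summable (\<lambda>k. 2 ^ k * (norm (D k \<omega>))\<^sup>2)"
      using that unfolding g_def by (intro summable_suminf_not_top) auto
    then have "summable (\<lambda>k. (1 / 2) ^ k + 2 ^ k * (norm (D k \<omega>))\<^sup>2)"
      by (intro summable_add summable_geometric) auto
    then show "summable (\<lambda>k. dist (psum v (S k) \<omega>) (psum v (S (Suc k)) \<omega>))"
    proof (rule summable_comparison_test')
      fix k :: nat
      \<comment> \<open>Either x is at most 2^(-k), or 2^k x \<ge> 1 and x is below 2^k x^2.\<close>
      have "x \<le> (1 / 2) ^ k + 2 ^ k * x\<^sup>2" if "x \<ge> 0" for x :: real
      proof (cases "x \<le> (1 / 2) ^ k")
        case False
        then have "1 \<le> 2 ^ k * x"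
          by (simp add: field_simps power_divide)
        then have "x * 1 \<le> x * (2 ^ k * x)"
          using that by (rule mult_left_mono)
        also have "\<dots> = 2 ^ k * x\<^sup>2"
          by (simp add: power2_eq_square)
        finally show ?thesis
          by (simp add: add_increasing)
      qed (simp add: add_increasing2)
      from this[of "norm (D k \<omega>)"]
      show "norm (dist (psum v (S k) \<omega>) (psum v (S (Suc k)) \<omega>)) \<le> (1 / 2) ^ k + 2 ^ k * (norm (D k \<omega>))\<^sup>2"
        by (simp add: D dist_norm)
    qed
  qed
  \<comment> \<open>The value 0 on the exceptional null set makes \<open>X\<close> an everywhere
    pointwise limit of measurable functions.\<close>
  define X where "X \<omega> = (if g \<omega> \<noteq> \<infinity> then lim (\<lambda>k. psum v (S k) \<omega>) else 0)" for \<omega>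
  have "X \<in> borel_measurable M"
  proof (rule borel_measurable_LIMSEQ_metric)
    show "(\<lambda>\<omega>. if g \<omega> \<noteq> \<infinity> then psum v (S k) \<omega> else 0) \<in> borel_measurable M" for k
      by measurable
    show "(\<lambda>k. if g \<omega> \<noteq> \<infinity> then psum v (S k) \<omega> else 0) \<longlonglongrightarrow> X \<omega>" for \<omega>
      using conv[of \<omega>] by (auto simp: X_def convergent_LIMSEQ_iff)
  qed
  moreover have "AE \<omega> in M. (\<lambda>k. psum v (S k) \<omega>) \<longlonglongrightarrow> X \<omega>"
    using AE by eventually_elim (use conv in \<open>auto simp: X_def convergent_LIMSEQ_iff\<close>)
  ultimately show ?thesis
    by (rule that)
qed

text \<open>The almost sure limit along one sequence of sets is the mean-square limit over the net
  of all finite sets: beyond \<open>F0\<close>, the remainder is itself the limit of partial sums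
  with small total coefficient mass. Since the sets \<open>S k\<close> may not exhaust the index
  type, coefficients outside them must vanish.\<close>

lemma L2_tendsto_psum:
  fixes v :: "'i \<Rightarrow> 'v :: real_inner"
  assumes S: "\<And>k. finite (S k)" "incseq S" and supp: "\<And>\<alpha>. \<alpha> \<notin> (\<Union>k. S k) \<Longrightarrow> v \<alpha> = 0"
    and lim: "AE \<omega> in M. (\<lambda>k. psum v (S k) \<omega>) \<longlonglongrightarrow> X \<omega>"
    and v: "(\<lambda>\<alpha>. (norm (v \<alpha>))\<^sup>2) summable_on UNIV"
  shows "L2_tendsto M (\<lambda>F \<omega>. psum v F \<omega>) X (finite_subsets_at_top UNIV)"
  unfolding L2_tendsto_def
proof (rule tendsto_zero_ennreal)
  fix r :: real assume "r > 0"
  from summable_on_small_tail[OF v _ half_gt_zero[OF this]] obtain F0 where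
    F0: "finite F0" "\<And>G. finite G \<Longrightarrow> G \<inter> F0 = {} \<Longrightarrow> (\<Sum>\<alpha>\<in>G. (norm (v \<alpha>))\<^sup>2) \<le> r / 2"
    by auto
  have "(\<integral>\<^sup>+ \<omega>. ennreal ((norm (psum v F \<omega> - X \<omega>))\<^sup>2) \<partial>M) < ennreal r" if F: "finite F" "F0 \<subseteq> F" for F
  proof -
    define w where "w \<alpha> = (if \<alpha> \<in> F then 0 else v \<alpha>)" for \<alpha>
    \<comment> \<open>From \<open>k0\<close> on, \<open>S k\<close> contains all of \<open>F\<close>
      except indices whose coefficient is 0, so \<open>psum v F\<close> is subtracted
      completely.\<close>
    obtain k0 where k0: "F \<inter> (\<Union>k. S k) \<subseteq> S k0"
    proof -
      have "\<forall>\<alpha>\<in>F \<inter> (\<Union>k. S k). \<exists>k. \<alpha> \<in> S k"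
        by auto
      then obtain h where h: "\<And>\<alpha>. \<alpha> \<in> F \<inter> (\<Union>k. S k) \<Longrightarrow> \<alpha> \<in> S (h \<alpha>)"
        by metis
      have "\<alpha> \<in> S (Max (h ` F))" if "\<alpha> \<in> F \<inter> (\<Union>k. S k)" for \<alpha>
      proof -
        have "h \<alpha> \<le> Max (h ` F)"
          using that F by (intro Max_ge) auto
        with h[OF that] S(2) show ?thesis
          by (auto simp: incseq_def)
      qed
      then show ?thesis
        using that by blast
    qed
    have eq: "psum w (S k) \<omega> = psum v (S k) \<omega> - psum v F \<omega>" if "k \<ge> k0" for k \<omega>
    proof -
      have "S k0 \<subseteq> S k"
        using S(2) that by (auto simp: incseq_def)
      then have "v \<alpha> = 0" if "\<alpha> \<in> F - S k" for \<alpha>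
        using k0 that by (intro supp) blast
      then have "psum v F \<omega> = psum v (F \<inter> S k) \<omega>"
        unfolding psum_def using F by (intro sum.mono_neutral_right) auto
      moreover have "psum v (S k) \<omega> = psum v (S k - F) \<omega> + psum v (F \<inter> S k) \<omega>"
        unfolding psum_def using S(1)
        by (subst sum.union_disjoint[symmetric]) (auto intro!: sum.cong)
      moreover have "psum w (S k) \<omega> = psum v (S k - F) \<omega>"
        unfolding psum_def w_def using S(1) by (intro sum.mono_neutral_cong_right) auto
      ultimately show ?thesis
        by simp
    qed
    have "AE \<omega> in M. (\<lambda>k. psum w (S k) \<omega>) \<longlonglongrightarrow> X \<omega> - psum v F \<omega>"
      using lim
    proof eventually_elim
      case (elim \<omega>)
      then have "(\<lambda>k. psum v (S k) \<omega> - psum v F \<omega>) \<longlonglongrightarrow> X \<omega> - psum v F \<omega>"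
        by (intro tendsto_intros)
      then show ?case
        by (rule Lim_transform_eventually) (auto simp: eventually_sequentially eq intro!: exI[of _ k0])
    qed
    then have "(\<integral>\<^sup>+\<omega>. ennreal ((norm (X \<omega> - psum v F \<omega>))\<^sup>2) \<partial>M) \<le> ennreal (r / 2)"
    proof (rule nn_integral_limit_le[OF S(1)])
      fix G :: "'i set" assume G: "finite G"
      have "(\<Sum>\<alpha>\<in>G. (norm (w \<alpha>))\<^sup>2) = (\<Sum>\<alpha>\<in>G - F. (norm (v \<alpha>))\<^sup>2)"
        unfolding w_def using G by (intro sum.mono_neutral_cong_right) auto
      also have "\<dots> \<le> r / 2"
        using G F by (intro F0(2)) auto
      finally show "(\<Sum>\<alpha>\<in>G. (norm (w \<alpha>))\<^sup>2) \<le> r / 2" .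
    qed
    also have "\<dots> < ennreal r"
      using \<open>r > 0\<close> by (intro ennreal_lessI) auto
    finally show ?thesis
      by (simp add: norm_minus_commute)
  qed
  then show "\<forall>\<^sub>F F in finite_subsets_at_top UNIV. (\<integral>\<^sup>+ \<omega>. ennreal ((norm (psum v F \<omega> - X \<omega>))\<^sup>2) \<partial>M) < ennreal r"
    unfolding eventually_finite_subsets_at_top using F0(1) by (intro exI[of _ F0]) auto
qed

text \<open>All levels \<open>y n\<close> and the full series \<open>z\<close> are summed along the
  same sets, so the identity between their finite partial sums passes to the almost sure limits
  \<open>X\<close> and \<open>Y n\<close>. The index \<iota> carries the constant term.\<close>

lemma graded_expansion:
  fixes z :: "'i \<Rightarrow> 'v :: {real_inner, complete_space}" and deg :: "'i \<Rightarrow> nat" and a :: "nat \<Rightarrow> real"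
  assumes z: "(\<lambda>\<alpha>. (norm (z \<alpha>))\<^sup>2) summable_on UNIV"
    and bot: "\<And>\<alpha>. deg \<alpha> = 0 \<longleftrightarrow> \<alpha> = \<iota>" "\<And>\<omega>. \<xi> \<iota> \<omega> = 1"
    and a: "\<And>n. a n \<noteq> 0"
    and y: "\<And>n \<alpha>. y n \<alpha> = (if deg \<alpha> = n then a n *\<^sub>R z \<alpha> else 0)"
  obtains X Y where
    "X \<in> borel_measurable M" "L2_tendsto M (\<lambda>F \<omega>. psum z F \<omega>) X (finite_subsets_at_top UNIV)"
    "\<And>n. Y n \<in> borel_measurable M"
    "\<And>n. L2_tendsto M (\<lambda>F \<omega>. psum (y n) F \<omega>) (Y n) (finite_subsets_at_top UNIV)"
    "L2_tendsto M (\<lambda>N \<omega>. z \<iota> + (\<Sum>n=1..N. (1 / a n) *\<^sub>R Y n \<omega>)) X sequentially"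
proof -
  let ?g = "\<lambda>\<alpha>. (norm (z \<alpha>))\<^sup>2"
  have "\<exists>F. finite F \<and> (\<forall>G. finite G \<longrightarrow> G \<inter> F = {} \<longrightarrow> sum ?g G \<le> 1 / 4 ^ k)" for k :: nat
    by (rule summable_on_small_tail[OF z, of "1 / 4 ^ k"]) auto
  then obtain T where T: "\<And>k. finite (T k)"
      "\<And>k G. finite G \<Longrightarrow> G \<inter> T k = {} \<Longrightarrow> sum ?g G \<le> 1 / 4 ^ k"
    by metis
  define S where "S k = (\<Union>i\<le>k. T i)" for k
  have S: "finite (S k)" "incseq S" for k
    using T(1) by (force simp: S_def incseq_def)+
  have tail: "sum ?g G \<le> 1 / 4 ^ k" if "finite G" "G \<inter> S k = {}" for k G
    using that by (intro T(2)) (auto simp: S_def)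
  \<comment> \<open>An index in none of the \<open>S k\<close> is subject to every tail bound, and
    these tend to 0.\<close>
  have supp: "z \<alpha> = 0" if "\<alpha> \<notin> (\<Union>k. S k)" for \<alpha>
  proof -
    have "?g \<alpha> \<le> (1 / 4) ^ k" for k
      using tail[of "{\<alpha>}" k] that by (auto simp: power_divide)
    moreover have "(\<lambda>k. (1 / 4 :: real) ^ k) \<longlonglongrightarrow> 0"
      by (rule LIMSEQ_power_zero) simp
    ultimately have "?g \<alpha> \<le> 0"
      by (intro LIMSEQ_le_const) auto
    then show ?thesis
      by simp
  qed
  have tail_y: "(\<Sum>\<alpha>\<in>G. (norm (y n \<alpha>))\<^sup>2) \<le> (a n)\<^sup>2 / 4 ^ k" if "finite G" "G \<inter> S k = {}" for n k G
  proof -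
    have "(\<Sum>\<alpha>\<in>G. (norm (y n \<alpha>))\<^sup>2) \<le> (\<Sum>\<alpha>\<in>G. (a n)\<^sup>2 * ?g \<alpha>)"
      by (intro sum_mono) (auto simp: y power_mult_distrib)
    also have "\<dots> \<le> (a n)\<^sup>2 * (1 / 4 ^ k)"
      unfolding sum_distrib_left[symmetric] using that by (intro mult_left_mono tail) auto
    finally show ?thesis
      by simp
  qed
  obtain X where X: "X \<in> borel_measurable M" "AE \<omega> in M. (\<lambda>k. psum z (S k) \<omega>) \<longlonglongrightarrow> X \<omega>"
    using psum_convergent_AE[OF S tail] by metis
  have "\<exists>Y. Y \<in> borel_measurable M \<and> (AE \<omega> in M. (\<lambda>k. psum (y n) (S k) \<omega>) \<longlonglongrightarrow> Y \<omega>)" for n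
    using psum_convergent_AE[OF S tail_y[of _ _ n]] by metis
  then obtain Y where Y: "\<And>n. Y n \<in> borel_measurable M"
      "\<And>n. AE \<omega> in M. (\<lambda>k. psum (y n) (S k) \<omega>) \<longlonglongrightarrow> Y n \<omega>"
    by metis
  have y_summable: "(\<lambda>\<alpha>. (norm (y n \<alpha>))\<^sup>2) summable_on UNIV" for n
  proof (rule summable_on_comparison_test)
    show "(\<lambda>\<alpha>. (a n)\<^sup>2 * ?g \<alpha>) summable_on UNIV"
      by (intro summable_on_cmult_right z)
  qed (auto simp: y power_mult_distrib)
  have supp_y: "y n \<alpha> = 0" if "\<alpha> \<notin> (\<Union>k. S k)" for n \<alpha>
    using supp[OF that] by (simp add: y)
  have "L2_tendsto M (\<lambda>N \<omega>. z \<iota> + (\<Sum>n=1..N. (1 / a n) *\<^sub>R Y n \<omega>)) X sequentially"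
    unfolding L2_tendsto_def
  proof (rule tendsto_zero_ennreal)
    fix r :: real assume "r > 0"
    from summable_on_small_tail[OF z _ half_gt_zero[OF this]] obtain F0 where
      F0: "finite F0" "\<And>G. finite G \<Longrightarrow> G \<inter> F0 = {} \<Longrightarrow> sum ?g G \<le> r / 2"
      by auto
    \<comment> \<open>Once \<open>N\<close> reaches the largest degree in \<open>F0\<close>, all
      indices of degree above \<open>N\<close> avoid \<open>F0\<close>; half of \<open>r\<close>
      keeps the inequality strict.\<close>
    have "(\<integral>\<^sup>+ \<omega>. ennreal ((norm (z \<iota> + (\<Sum>n=1..N. (1 / a n) *\<^sub>R Y n \<omega>) - X \<omega>))\<^sup>2) \<partial>M) < ennreal r"
      if N: "N \<ge> Max (deg ` F0)" for N
    proof -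
      define w where "w \<alpha> = (if deg \<alpha> \<le> N then 0 else z \<alpha>)" for \<alpha>
      \<comment> \<open>Here \<open>w\<close> is the part of degree above \<open>N\<close>, and
        \<iota> accounts for degree 0.\<close>
      have z_split: "z \<alpha> = w \<alpha> + (if \<alpha> = \<iota> then z \<iota> else 0) + (\<Sum>n=1..N. (1 / a n) *\<^sub>R y n \<alpha>)" for \<alpha>
      proof -
        have "(\<Sum>n=1..N. (1 / a n) *\<^sub>R y n \<alpha>) = (\<Sum>n=1..N. if deg \<alpha> = n then z \<alpha> else 0)"
          using a by (intro sum.cong) (auto simp: y)
        also have "\<dots> = (if deg \<alpha> \<in> {1..N} then z \<alpha> else 0)"
          by (simp add: sum.delta)
        finally show ?thesis
          using bot(1)[of \<alpha>] by (auto simp: w_def)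
      qed
      have psum_split: "psum w (S k) \<omega>
        = psum z (S k) \<omega> - (if \<iota> \<in> S k then z \<iota> else 0) - (\<Sum>n=1..N. (1 / a n) *\<^sub>R psum (y n) (S k) \<omega>)" for k \<omega>
      proof -
        have z_split': "\<xi> \<alpha> \<omega> *\<^sub>R z \<alpha> = \<xi> \<alpha> \<omega> *\<^sub>R w \<alpha> + (if \<alpha> = \<iota> then \<xi> \<alpha> \<omega> *\<^sub>R z \<iota> else 0)
            + (\<Sum>n=1..N. (1 / a n) *\<^sub>R (\<xi> \<alpha> \<omega> *\<^sub>R y n \<alpha>))" for \<alpha>
        proof -
          have "\<xi> \<alpha> \<omega> *\<^sub>R z \<alpha> = \<xi> \<alpha> \<omega> *\<^sub>R w \<alpha> + \<xi> \<alpha> \<omega> *\<^sub>R (if \<alpha> = \<iota> then z \<iota> else 0)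
            + \<xi> \<alpha> \<omega> *\<^sub>R (\<Sum>n=1..N. (1 / a n) *\<^sub>R y n \<alpha>)"
            by (simp only: scaleR_add_right[symmetric] z_split[symmetric])
          then show ?thesis
            by (simp add: scaleR_sum_right if_distrib cong: if_cong)
        qed
        have "psum z (S k) \<omega> = (\<Sum>\<alpha>\<in>S k. \<xi> \<alpha> \<omega> *\<^sub>R w \<alpha> + (if \<alpha> = \<iota> then \<xi> \<alpha> \<omega> *\<^sub>R z \<iota> else 0)
            + (\<Sum>n=1..N. (1 / a n) *\<^sub>R (\<xi> \<alpha> \<omega> *\<^sub>R y n \<alpha>)))"
          unfolding psum_def by (rule sum.cong[OF refl z_split'])
        also have "\<dots> = psum w (S k) \<omega> + (if \<iota> \<in> S k then z \<iota> else 0)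
            + (\<Sum>n=1..N. (1 / a n) *\<^sub>R psum (y n) (S k) \<omega>)"
          unfolding psum_def scaleR_sum_right sum.distrib
          using S(1) sum.swap[of "\<lambda>\<alpha> n. (1 / a n) *\<^sub>R (\<xi> \<alpha> \<omega> *\<^sub>R y n \<alpha>)" "{1..N}" "S k"]
          by (simp add: bot(2))
        finally show ?thesis
          by simp
      qed
      have lim_bot: "(\<lambda>k. if \<iota> \<in> S k then z \<iota> else 0) \<longlonglongrightarrow> z \<iota>"
      proof (cases "\<iota> \<in> (\<Union>k. S k)")
        case True
        then obtain k0 where "\<iota> \<in> S k0"
          by blast
        then have "\<iota> \<in> S k" if "k \<ge> k0" for k
          using S(2) that by (auto simp: incseq_def)
        then have "\<forall>\<^sub>F k in sequentially. (if \<iota> \<in> S k then z \<iota> else 0) = z \<iota>"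
          by (auto simp: eventually_sequentially intro!: exI[of _ k0])
        then show ?thesis
          by (rule tendsto_eventually)
      qed (use supp in auto)
      have "AE \<omega> in M. \<forall>n. (\<lambda>k. psum (y n) (S k) \<omega>) \<longlonglongrightarrow> Y n \<omega>"
        using Y(2) by (simp add: AE_all_countable)
      with X(2) have "AE \<omega> in M. (\<lambda>k. psum w (S k) \<omega>)
        \<longlonglongrightarrow> X \<omega> - z \<iota> - (\<Sum>n=1..N. (1 / a n) *\<^sub>R Y n \<omega>)"
      proof eventually_elim
        case (elim \<omega>)
        show ?case
          unfolding psum_split by (intro tendsto_intros lim_bot elim(1) elim(2)[rule_format])
      qed
      then have "(\<integral>\<^sup>+\<omega>. ennreal ((norm (X \<omega> - z \<iota> - (\<Sum>n=1..N. (1 / a n) *\<^sub>R Y n \<omega>)))\<^sup>2) \<partial>M) \<le> ennreal (r / 2)"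
      proof (rule nn_integral_limit_le[OF S(1)])
        fix G :: "'i set" assume G: "finite G"
        have "(\<Sum>\<alpha>\<in>G. (norm (w \<alpha>))\<^sup>2) = sum ?g {\<alpha> \<in> G. deg \<alpha> > N}"
          unfolding w_def using G by (intro sum.mono_neutral_cong_right) auto
        also have "\<dots> \<le> r / 2"
        proof (rule F0(2))
          have "deg \<alpha> \<le> N" if "\<alpha> \<in> F0" for \<alpha>
            using N F0(1) that by (meson Max_ge finite_imageI imageI order_trans)
          then show "{\<alpha> \<in> G. deg \<alpha> > N} \<inter> F0 = {}"
            by fastforce
        qed (use G in auto)
        finally show "(\<Sum>\<alpha>\<in>G. (norm (w \<alpha>))\<^sup>2) \<le> r / 2" .
      qed
      also have "\<dots> < ennreal r"
        using \<open>r > 0\<close> by (intro ennreal_lessI) auto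
      finally show ?thesis
        by (subst norm_minus_commute) (simp add: algebra_simps)
    qed
    then show "\<forall>\<^sub>F N in sequentially.
      (\<integral>\<^sup>+ \<omega>. ennreal ((norm (z \<iota> + (\<Sum>n=1..N. (1 / a n) *\<^sub>R Y n \<omega>) - X \<omega>))\<^sup>2) \<partial>M) < ennreal r"
      by (auto simp: eventually_sequentially)
  qed
  moreover have "L2_tendsto M (\<lambda>F \<omega>. psum z F \<omega>) X (finite_subsets_at_top UNIV)"
    by (rule L2_tendsto_psum[OF S supp X(2) z])
  moreover have "L2_tendsto M (\<lambda>F \<omega>. psum (y n) F \<omega>) (Y n) (finite_subsets_at_top UNIV)" for n
    by (rule L2_tendsto_psum[OF S supp_y Y(2) y_summable])
  ultimately show ?thesis
    using that X(1) Y(1) by blast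
qed

end

subsection \<open>The Wiener chaos basis\<close>

text \<open>A common finite set \<open>T\<close> allows two basis elements to be multiplied factor
  by factor; positions outside the support contribute 1. The normalisation is absorbed into the
  polynomial.\<close>

lemma chaos_basis_eq_prod:
  assumes "finite T" "Poly_Mapping.keys \<alpha> \<subseteq> T"
  shows "chaos_basis W e \<alpha> \<omega> = (\<Prod>k\<in>T. poly (smult (1 / sqrt (fact (Poly_Mapping.lookup \<alpha> k)))
    (hermite_poly (Poly_Mapping.lookup \<alpha> k))) (W (e k) \<omega>))"
  unfolding chaos_basis_def hermite_eq_poly
  by (subst prod_keys_superset[OF assms, where g = "\<lambda>k n. poly (hermite_poly n) (W (e k) \<omega>) / sqrt (fact n)"])
    auto

context wiener_chaos
begin

lemma inj_basis: "inj e"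
proof (rule injI)
  fix j k assume "e j = e k"
  with basis_orthonormal[of j j] basis_orthonormal[of j k] show "j = k"
    by (auto split: if_splits)
qed

sublocale gaussian: orthonormal_gaussian_sequence P "\<lambda>k. W (e k)"
proof
  fix S :: "nat set" and c :: "nat \<Rightarrow> real" assume "finite S"
  \<comment> \<open>The Gaussian family takes coefficients indexed by vectors, so those of the
    sequence are transported through \<open>inv e\<close>.\<close>
  then have "centered_gaussian P (\<lambda>\<omega>. \<Sum>h\<in>e ` S. c (inv e h) * W h \<omega>)"
    using noise_gaussian by (simp add: centered_gaussian_family_def)
  then show "centered_gaussian P (\<lambda>\<omega>. \<Sum>k\<in>S. c k * W (e k) \<omega>)"
    using inj_basis by (simp add: sum.reindex inj_on_subset[OF inj_basis])
next
  show "expectation (\<lambda>\<omega>. W (e j) \<omega> * W (e k) \<omega>) = (if j = k then 1 else 0)" for j k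
    by (simp add: noise_covariance basis_orthonormal)
qed

lemma has_moments_chaos_basis: "has_moments (chaos_basis W e \<alpha>)"
proof -
  have "chaos_basis W e \<alpha> = (\<lambda>\<omega>. \<Prod>k\<in>Poly_Mapping.keys \<alpha>. poly (smult (1 / sqrt (fact (Poly_Mapping.lookup \<alpha> k)))
    (hermite_poly (Poly_Mapping.lookup \<alpha> k))) (W (e k) \<omega>))"
    by (rule ext, rule chaos_basis_eq_prod) auto
  then show ?thesis
    by (auto intro!: has_moments_prod has_moments_poly gaussian.has_moments_X simp del: poly_smult)
qed

lemma chaos_basis_orthonormal:
  "expectation (\<lambda>\<omega>. chaos_basis W e \<alpha> \<omega> * chaos_basis W e \<beta> \<omega>) = (if \<alpha> = \<beta> then 1 else 0)"
proof -
  define T where "T = Poly_Mapping.keys \<alpha> \<union> Poly_Mapping.keys \<beta>"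
  have T: "finite T" "Poly_Mapping.keys \<alpha> \<subseteq> T" "Poly_Mapping.keys \<beta> \<subseteq> T"
    by (auto simp: T_def)
  let ?p = "\<lambda>\<gamma> k. smult (1 / sqrt (fact (Poly_Mapping.lookup \<gamma> k))) (hermite_poly (Poly_Mapping.lookup \<gamma> k))"
  have "expectation (\<lambda>\<omega>. chaos_basis W e \<alpha> \<omega> * chaos_basis W e \<beta> \<omega>)
      = expectation (\<lambda>\<omega>. \<Prod>k\<in>T. poly (?p \<alpha> k * ?p \<beta> k) (W (e k) \<omega>))"
    by (simp only: chaos_basis_eq_prod[OF T(1,2)] chaos_basis_eq_prod[OF T(1,3)] poly_mult prod.distrib)
  also have "\<dots> = (\<Prod>k\<in>T. gauss_eval (?p \<alpha> k * ?p \<beta> k))"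
    by (rule gaussian.expectation_prod_poly[OF T(1)])
  also have "\<dots> = (\<Prod>k\<in>T. if Poly_Mapping.lookup \<alpha> k = Poly_Mapping.lookup \<beta> k then 1 else 0)"
    by (intro prod.cong refl) (simp add: gauss_eval_smult hermite_poly_orthogonal)
  also have "\<dots> = (if \<alpha> = \<beta> then 1 else 0)"
  proof (cases "\<alpha> = \<beta>")
    case False
    then obtain k where k: "Poly_Mapping.lookup \<alpha> k \<noteq> Poly_Mapping.lookup \<beta> k"
      using poly_mapping_eqI[of \<alpha> \<beta>] by blast
    then have "k \<in> T"
      by (auto simp: T_def in_keys_iff)
    with k T(1) False show ?thesis
      by (auto intro!: prod_zero)
  qed simp
  finally show ?thesis .
qed

sublocale chaos: orthonormal_system P "chaos_basis W e"
proof
  show "chaos_basis W e \<alpha> \<in> borel_measurable P" for \<alpha>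
    by (rule has_moments_measurable[OF has_moments_chaos_basis])
  show "integrable P (\<lambda>\<omega>. chaos_basis W e \<alpha> \<omega> * chaos_basis W e \<beta> \<omega>)" for \<alpha> \<beta>
    by (intro has_moments_integrable has_moments_mult has_moments_chaos_basis)
qed (rule chaos_basis_orthonormal)

lemma has_chaos_expansion_iff:
  "has_chaos_expansion P W e X v \<longleftrightarrow> X \<in> borel_measurable P
    \<and> L2_tendsto P (\<lambda>F \<omega>. chaos.psum v F \<omega>) X (finite_subsets_at_top UNIV)"
  by (simp add: has_chaos_expansion_def chaos.psum_def)

end

subsection \<open>The stochastic equation\<close>

theorem theorem5:
  fixes P :: "'a measure"
    and W :: "'u :: {real_inner, complete_space, second_countable_topology} \<Rightarrow> 'a \<Rightarrow> real"
    and e :: "nat \<Rightarrow> 'u"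
    and i :: "'v :: {real_inner, complete_space} \<Rightarrow> 'h :: {real_inner, complete_space}"
    and j :: "'h \<Rightarrow> 'w :: {real_inner, complete_space}"
    and A :: "'v \<Rightarrow> 'w"
    and M :: "nat \<Rightarrow> 'v \<Rightarrow> 'w"
    and C\<^sub>A :: real
    and C :: "nat \<Rightarrow> real"
    and f :: 'w
    and u :: "'v chaos_series"
    and B :: "nat \<Rightarrow> 'v \<Rightarrow> 'v"
  assumes "wiener_chaos P W e"
    and "normal_triple i j"
    and "bounded_linear A"
    and "\<And>F. \<exists>!U. A U = F"
    and "\<And>F. norm (inv A F) \<le> C\<^sub>A * norm F"
    and "\<And>k. bounded_linear (M k)"
    and "\<And>k v. norm (inv A (M k v)) \<le> C k * norm v"
    and "chaos_solution A M f u"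
    and "B = (\<lambda>k v. - inv A (M k v))"
  shows "u 0 = inv A f
    \<and> (\<forall>\<alpha>. mi_deg \<alpha> \<ge> 1 \<longrightarrow>
        u \<alpha> = (1 / sqrt (real (mi_fact \<alpha>))) *\<^sub>R
          (\<Sum>\<sigma> | \<sigma> permutes {..<mi_deg \<alpha>}.
             fold (\<lambda>l. B (characteristic_set \<alpha> ! \<sigma> l)) [0..<mi_deg \<alpha>] (u 0)))
    \<and> (\<forall>q r Bbar.
        (\<forall>k. q k > 0) \<and> summable (\<lambda>k. (q k)\<^sup>2 * (C k)\<^sup>2) \<and> suminf (\<lambda>k. (q k)\<^sup>2 * (C k)\<^sup>2) < 1 \<and>
        r = (\<lambda>\<alpha>. mi_power q \<alpha> / sqrt (fact (mi_deg \<alpha>))) \<and>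
        Bbar = (\<lambda>k v. - (q k *\<^sub>R inv A (M k v))) \<longrightarrow>
        u \<in> weighted_L2 r
        \<and> (\<forall>n\<ge>1. (\<lambda>\<alpha>. if mi_deg \<alpha> = n then mi_power q \<alpha> *\<^sub>R u \<alpha> else 0)
                 = skorohod_iter Bbar n (nonrandom (inv A f)))
        \<and> (\<forall>\<alpha>. (\<lambda>n. (1 / sqrt (fact (Suc n))) *\<^sub>R
                      skorohod_iter Bbar (Suc n) (nonrandom (inv A f)) \<alpha>)
               sums (weight_op r u \<alpha> - nonrandom (inv A f) \<alpha>))
        \<and> (\<exists>X Y. has_chaos_expansion P W e X (weight_op r u)
             \<and> (\<forall>n\<ge>1. has_chaos_expansion P W e (Y n)
                        (skorohod_iter Bbar n (nonrandom (inv A f))))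
             \<and> L2_tendsto P
                 (\<lambda>N \<omega>. inv A f + (\<Sum>n=1..N. (1 / sqrt (fact n)) *\<^sub>R Y n \<omega>)) X sequentially))"
proof (intro conjI allI impI)
  interpret wiener_chaos P W e
    by fact
  interpret A: bounded_linear A
    by fact

  \<comment> \<open>Inversion of \<open>A\<close> and the recursion for the coefficients\<close>
  have A_inv: "A (inv A F) = F" and inv_A: "inv A (A v) = v" for F v
    using assms(4) by (metis bijI inj_def surj_def surj_f_inv_f, metis inj_def inv_f_f)
  have linear_inv: "linear (inv A)"
  proof (rule linearI)
    show "inv A (x + y) = inv A x + inv A y" for x y
      by (metis A.add A_inv inv_A)
    show "inv A (c *\<^sub>R x) = c *\<^sub>R inv A x" for c x
      by (metis A.scaleR A_inv inv_A)
  qed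
  have B: "B k v = - inv A (M k v)" for k v
    by (simp add: assms(9))
  have linear_B: "linear (B k)" for k
    using linear_compose[OF bounded_linear.linear[OF assms(6)[of k]] linear_inv]
    by (auto simp: B linear_iff comp_def)
  have solution: "A (u \<alpha>) + skorohod M u \<alpha> = nonrandom f \<alpha>" for \<alpha>
    using assms(8) by (simp add: chaos_solution_def)
  show u0: "u 0 = inv A f"
    using solution[of 0] inv_A[of "u 0"] by (simp add: skorohod_def nonrandom_def)
  have rec: "u \<alpha> = skorohod B u \<alpha>" if "\<alpha> \<noteq> 0" for \<alpha>
  proof -
    have "A (u \<alpha>) = - skorohod M u \<alpha>"
      using solution[of \<alpha>] that by (simp add: nonrandom_def add_eq_0_iff2)
    then have "u \<alpha> = - inv A (skorohod M u \<alpha>)"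
      by (metis inv_A linear_neg[OF linear_inv])
    also have "\<dots> = skorohod B u \<alpha>"
      by (simp add: skorohod_def B linear_sum[OF linear_inv] linear_scale[OF linear_inv] sum_negf)
    finally show ?thesis .
  qed

  \<comment> \<open>The permutation formula for the coefficients\<close>
  show "u \<alpha> = (1 / sqrt (real (mi_fact \<alpha>))) *\<^sub>R
      (\<Sum>\<sigma> | \<sigma> permutes {..<mi_deg \<alpha>}.
         fold (\<lambda>l. B (characteristic_set \<alpha> ! \<sigma> l)) [0..<mi_deg \<alpha>] (u 0))" for \<alpha>
    using mi_fact_pos[of \<alpha>]
    by (subst coefficient_eq_sum_permutations[OF linear_B rec count_characteristic_set refl, symmetric]) auto

  \<comment> \<open>Rescaled coefficients and weighted summability\<close>
  fix q r Bbar
  assume "(\<forall>k. q k > 0) \<and> summable (\<lambda>k. (q k)\<^sup>2 * (C k)\<^sup>2) \<and> suminf (\<lambda>k. (q k)\<^sup>2 * (C k)\<^sup>2) < 1 \<and>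
    r = (\<lambda>\<alpha>. mi_power q \<alpha> / sqrt (fact (mi_deg \<alpha>))) \<and> Bbar = (\<lambda>k v. - (q k *\<^sub>R inv A (M k v)))"
  \<comment> \<open>The summability condition is rewritten with squares of \<open>q k * C k\<close>,
    which are the operator bounds of \<open>Bbar k\<close>.\<close>
  then have q: "\<And>k. q k > 0" "summable (\<lambda>k. (q k * C k)\<^sup>2)" "suminf (\<lambda>k. (q k * C k)\<^sup>2) < 1"
    and r: "r = (\<lambda>\<alpha>. mi_power q \<alpha> / sqrt (fact (mi_deg \<alpha>)))"
    and Bbar: "Bbar = (\<lambda>k v. q k *\<^sub>R B k v)"
    by (auto simp: power_mult_distrib B)
  define w where "w \<alpha> = mi_power q \<alpha> *\<^sub>R u \<alpha>" for \<alpha>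
  have w0: "w 0 = inv A f"
    by (simp add: w_def u0)
  have linear_Bbar: "linear (Bbar k)" for k
    unfolding Bbar by (intro linear_compose_scale_right linear_B)
  have rec_w: "w \<alpha> = skorohod Bbar w \<alpha>" if "\<alpha> \<noteq> 0" for \<alpha>
  proof -
    have "w \<alpha> = mi_power q \<alpha> *\<^sub>R skorohod B u \<alpha>"
      by (simp add: w_def flip: rec[OF that])
    also have "\<dots> = skorohod Bbar w \<alpha>"
      unfolding skorohod_def scaleR_sum_right w_def Bbar
      \<comment> \<open>The weight splits as q_k times the weight of \<alpha> - \<epsilon>_k; the
        factor q_k goes into the operator.\<close>
      by (intro sum.cong refl) (simp add: linear_scale[OF linear_B] mi_power_diff_mi_unit mult_ac)
    finally show ?thesis .
  qed
  have norm_Bbar: "norm (Bbar k v) \<le> q k * C k * norm v" for k v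
    using assms(7)[of k v] q(1)[of k] by (simp add: Bbar B mult.assoc)
  have r_u: "weight_op r u \<alpha> = (1 / sqrt (fact (mi_deg \<alpha>))) *\<^sub>R w \<alpha>" for \<alpha>
    by (simp add: weight_op_def r w_def)
  have norm_r_u: "(norm (weight_op r u \<alpha>))\<^sup>2 = (norm (w \<alpha>))\<^sup>2 / fact (mi_deg \<alpha>)" for \<alpha>
    by (simp add: r_u power_divide)
  have summable: "(\<lambda>\<alpha>. (norm (weight_op r u \<alpha>))\<^sup>2) summable_on UNIV"
    unfolding norm_r_u by (rule weighted_coefficients_summable[OF norm_Bbar rec_w q(2,3)])
  then show "u \<in> weighted_L2 r"
    by (simp add: weighted_L2_def weight_op_def power_mult_distrib)

  \<comment> \<open>Levels as iterates of \<delta>, and the coefficientwise series\<close>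
  have iter: "skorohod_iter Bbar n (nonrandom (inv A f)) = (\<lambda>\<alpha>. if mi_deg \<alpha> = n then w \<alpha> else 0)" for n
    unfolding w0[symmetric] by (rule skorohod_iter_nonrandom[OF linear_Bbar rec_w])
  show "(\<lambda>\<alpha>. if mi_deg \<alpha> = n then mi_power q \<alpha> *\<^sub>R u \<alpha> else 0)
      = skorohod_iter Bbar n (nonrandom (inv A f))" for n
    unfolding iter w_def ..
  \<comment> \<open>At a fixed \<alpha> only the term with \<open>Suc n\<close> equal to the degree
    survives. In degree 0 all terms vanish and the constant cancels on the right.\<close>
  show "(\<lambda>n. (1 / sqrt (fact (Suc n))) *\<^sub>R skorohod_iter Bbar (Suc n) (nonrandom (inv A f)) \<alpha>)
      sums (weight_op r u \<alpha> - nonrandom (inv A f) \<alpha>)" for \<alpha>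
  proof (cases "mi_deg \<alpha>")
    case 0
    then show ?thesis
      unfolding iter by (simp add: mi_deg_eq_0_iff r_u w0 nonrandom_def)
  next
    case (Suc m)
    then have "\<alpha> \<noteq> 0"
      by auto
    have "(\<lambda>n. if n = m then (1 / sqrt (fact (Suc n))) *\<^sub>R w \<alpha> else 0) sums ((1 / sqrt (fact (Suc m))) *\<^sub>R w \<alpha>)"
      by (rule sums_single)
    also have "(\<lambda>n. if n = m then (1 / sqrt (fact (Suc n))) *\<^sub>R w \<alpha> else 0)
      = (\<lambda>n. (1 / sqrt (fact (Suc n))) *\<^sub>R skorohod_iter Bbar (Suc n) (nonrandom (inv A f)) \<alpha>)"
      unfolding iter Suc by auto
    finally show ?thesis
      using \<open>\<alpha> \<noteq> 0\<close> by (simp only: r_u Suc nonrandom_def) simp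
  qed

  \<comment> \<open>The expansion of the weighted solution in mean square\<close>
  obtain X Y where
    X: "X \<in> borel_measurable P"
      "L2_tendsto P (\<lambda>F \<omega>. chaos.psum (weight_op r u) F \<omega>) X (finite_subsets_at_top UNIV)" and
    Y: "\<And>n. Y n \<in> borel_measurable P"
      "\<And>n. L2_tendsto P (\<lambda>F \<omega>. chaos.psum (skorohod_iter Bbar n (nonrandom (inv A f))) F \<omega>)
        (Y n) (finite_subsets_at_top UNIV)" and
    sum: "L2_tendsto P (\<lambda>N \<omega>. weight_op r u 0 + (\<Sum>n=1..N. (1 / sqrt (fact n)) *\<^sub>R Y n \<omega>)) X sequentially"
  \<comment> \<open>The scaling factors are \<open>sqrt (fact n)\<close>: on level n, the iterate of
    \<delta> is that multiple of the weighted solution.\<close>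
  proof (rule chaos.graded_expansion[OF summable])
    show "mi_deg \<alpha> = 0 \<longleftrightarrow> \<alpha> = 0" for \<alpha>
      by (rule mi_deg_eq_0_iff)
    show "chaos_basis W e 0 \<omega> = 1" for \<omega>
      by (simp add: chaos_basis_def)
    show "sqrt (fact n) \<noteq> (0 :: real)" for n
      by simp
    show "skorohod_iter Bbar n (nonrandom (inv A f)) \<alpha>
      = (if mi_deg \<alpha> = n then sqrt (fact n) *\<^sub>R weight_op r u \<alpha> else 0)" for n \<alpha>
      by (auto simp: iter r_u)
  qed (assumption | rule that)+
  moreover have "weight_op r u 0 = inv A f"
    by (simp add: r_u w0)
  ultimately show "\<exists>X Y. has_chaos_expansion P W e X (weight_op r u)
      \<and> (\<forall>n\<ge>1. has_chaos_expansion P W e (Y n) (skorohod_iter Bbar n (nonrandom (inv A f))))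
      \<and> L2_tendsto P (\<lambda>N \<omega>. inv A f + (\<Sum>n=1..N. (1 / sqrt (fact n)) *\<^sub>R Y n \<omega>)) X sequentially"
    unfolding has_chaos_expansion_iff by (intro exI[of _ X] exI[of _ Y]) simp
qed

end
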